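(* There is no polynomial-time algorithm that solves \textsc{ConsCheck: $2$-Coloring} unless $\mathsf{P}=\mathsf{NP}$.
   Context: \textsc{ConsCheck: $2$-Coloring} is the following problem. Input: a finite vertex set $V$ and a list of labeled samples $(E_i,\lambda_i)_{i\in[t]}$, where for each $i\in[t]$, $G_i=(V,E_i)$ is a graph and $\lambda_i\in\{0,1\}$. Task: compute a set $X\subseteq V$ such that for every $i\in[t]$, $(X,V\setminus X)$ is a proper $2$-coloring of $G_i$ (i.e., both $X$ and $V\setminus X$ are independent sets in $G_i$) if and only if $\lambda_i=1$; or correctly report that no such set exists. *)

theory Defs
  imports Main "HOL-Computational_Algebra.Polynomial"
begin

section \<open>Multi-tape Turing machines\<close>

datatype symbol = Blank | Bit bool | Aux nat

datatype dir = Lft | Stay | Rgt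

text \<open>
  A transition \<open>(q, rs, q', as)\<close> applies in state \<open>q\<close> when the heads read the symbols \<open>rs\<close>, one per
  tape; it enters state \<open>q'\<close> and, on each tape, writes a symbol and then moves the head as given
  by \<open>as\<close>. Several transitions may apply, so machines are nondeterministic in general. The finite
  state set and the finite tape alphabet are those occurring in the finitely many transitions.
\<close>

type_synonym trans = "nat \<times> symbol list \<times> nat \<times> (symbol \<times> dir) list"

record tm =
  tapes :: nat
  start :: nat
  accepting :: "nat set"
  transitions :: "trans set"

definition wf_tm :: "tm \<Rightarrow> bool" where
  "wf_tm M \<longleftrightarrow> 1 \<le> tapes M \<and> finite (accepting M) \<and> finite (transitions M) \<and>
     (\<forall>(q, rs, q', as) \<in> transitions M. length rs = tapes M \<and> length as = tapes M)"

definition deterministic :: "tm \<Rightarrow> bool" where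
  "deterministic M \<longleftrightarrow>
     (\<forall>q rs q1 as1 q2 as2. (q, rs, q1, as1) \<in> transitions M \<and> (q, rs, q2, as2) \<in> transitions M
        \<longrightarrow> q1 = q2 \<and> as1 = as2)"

text \<open>A tape is two-way infinite and comes with its head position.\<close>

type_synonym tape = "(int \<Rightarrow> symbol) \<times> int"

type_synonym config = "nat \<times> tape list"

fun read_tape :: "tape \<Rightarrow> symbol" where
  "read_tape (f, i) = f i"

fun move :: "dir \<Rightarrow> int \<Rightarrow> int" where
  "move Lft i = i - 1"
| "move Stay i = i"
| "move Rgt i = i + 1"

fun act :: "symbol \<times> dir \<Rightarrow> tape \<Rightarrow> tape" where
  "act (s, d) (f, i) = (f(i := s), move d i)"

inductive step :: "tm \<Rightarrow> config \<Rightarrow> config \<Rightarrow> bool" for M where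
  "(q, map read_tape ts, q', as) \<in> transitions M \<Longrightarrow> step M (q, ts) (q', map2 act as ts)"

definition blank_tape :: tape where
  "blank_tape = (\<lambda>_. Blank, 0)"

definition input_tape :: "bool list \<Rightarrow> tape" where
  "input_tape x = (\<lambda>i. if 0 \<le> i \<and> i < int (length x) then Bit (x ! nat i) else Blank, 0)"

definition init :: "tm \<Rightarrow> bool list \<Rightarrow> config" where
  "init M x = (start M, input_tape x # replicate (tapes M - 1) blank_tape)"

definition halted :: "tm \<Rightarrow> config \<Rightarrow> bool" where
  "halted M c \<longleftrightarrow> (\<nexists>c'. step M c c')"

definition halts_with :: "tm \<Rightarrow> bool list \<Rightarrow> config \<Rightarrow> bool" where
  "halts_with M x c \<longleftrightarrow> (step M)\<^sup>*\<^sup>* (init M x) c \<and> halted M c"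

definition accepts :: "tm \<Rightarrow> bool list \<Rightarrow> bool" where
  "accepts M x \<longleftrightarrow> (\<exists>c. halts_with M x c \<and> fst c \<in> accepting M)"

text \<open>The output is the bit string that starts at the head of the first tape and is followed by a blank.\<close>

fun tape_output :: "tape \<Rightarrow> bool list \<Rightarrow> bool" where
  "tape_output (f, i) w \<longleftrightarrow>
     (\<forall>j < length w. f (i + int j) = Bit (w ! j)) \<and> f (i + int (length w)) = Blank"

definition outputs :: "tm \<Rightarrow> bool list \<Rightarrow> bool list \<Rightarrow> bool" where
  "outputs M x w \<longleftrightarrow> (\<exists>c. halts_with M x c \<and> tape_output (hd (snd c)) w)"

text \<open>Polynomial running time: every computation on an input from \<open>A\<close>, along every
  nondeterministic branch, stops within the bound.\<close>

definition poly_time_on :: "tm \<Rightarrow> bool list set \<Rightarrow> bool" where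
  "poly_time_on M A \<longleftrightarrow>
     (\<exists>p :: nat poly. \<forall>x\<in>A. \<forall>m c. (step M ^^ m) (init M x) c \<longrightarrow> m \<le> poly p (length x))"


section \<open>The classes P and NP\<close>

definition class_P :: "bool list set set" where
  "class_P = {L. \<exists>M. wf_tm M \<and> deterministic M \<and> poly_time_on M UNIV \<and> L = {x. accepts M x}}"

definition class_NP :: "bool list set set" where
  "class_NP = {L. \<exists>M. wf_tm M \<and> poly_time_on M UNIV \<and> L = {x. accepts M x}}"


section \<open>Consistency checking for 2-colorings\<close>

definition graph :: "'v set \<Rightarrow> 'v set set \<Rightarrow> bool" where
  "graph V E \<longleftrightarrow> finite V \<and> (\<forall>e\<in>E. e \<subseteq> V \<and> card e = 2)"

definition independent :: "'v set set \<Rightarrow> 'v set \<Rightarrow> bool" where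
  "independent E S \<longleftrightarrow> (\<forall>u\<in>S. \<forall>v\<in>S. {u, v} \<notin> E)"

definition proper_2_coloring :: "'v set \<Rightarrow> 'v set set \<Rightarrow> 'v set \<Rightarrow> bool" where
  "proper_2_coloring V E X \<longleftrightarrow> independent E X \<and> independent E (V - X)"

definition consistent :: "'v set \<Rightarrow> ('v set set \<times> bool) list \<Rightarrow> 'v set \<Rightarrow> bool" where
  "consistent V S X \<longleftrightarrow> X \<subseteq> V \<and> (\<forall>(E, l) \<in> set S. proper_2_coloring V E X \<longleftrightarrow> l)"

text \<open>\<open>None\<close> is the report that no consistent set exists.\<close>

fun correct_answer :: "'v set \<Rightarrow> ('v set set \<times> bool) list \<Rightarrow> 'v set option \<Rightarrow> bool" where
  "correct_answer V S (Some X) \<longleftrightarrow> consistent V S X"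
| "correct_answer V S None \<longleftrightarrow> (\<nexists>X. consistent V S X)"


section \<open>Instances as bit strings\<close>

text \<open>
  An instance is given to a machine as a number \<open>n\<close>, standing for the vertex set \<open>{..<n}\<close>, and a
  list of labeled edge lists. The edges of a graph may be listed in any order and orientation.
\<close>

type_synonym inst = "nat \<times> ((nat \<times> nat) list \<times> bool) list"

definition edge_set :: "('v \<times> 'v) list \<Rightarrow> 'v set set" where
  "edge_set es = (\<lambda>(u, v). {u, v}) ` set es"

definition samples :: "(('v \<times> 'v) list \<times> bool) list \<Rightarrow> ('v set set \<times> bool) list" where
  "samples ss = map (\<lambda>(es, l). (edge_set es, l)) ss"

definition instances :: "inst set" where
  "instances = {(n, ss). \<forall>(E, l) \<in> set (samples ss). graph {..<n} E}"

text \<open>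
  Vertices are written in unary. As they are smaller than \<open>n = |V|\<close>, the code length is polynomial
  in the number of vertices, edges and samples, just as for binary vertex names.
\<close>

definition enc_nat :: "nat \<Rightarrow> bool list" where
  "enc_nat n = replicate n True @ [False]"

definition enc_list :: "('a \<Rightarrow> bool list) \<Rightarrow> 'a list \<Rightarrow> bool list" where
  "enc_list enc xs = concat (map (\<lambda>x. True # enc x) xs) @ [False]"

fun enc_edge :: "nat \<times> nat \<Rightarrow> bool list" where
  "enc_edge (u, v) = enc_nat u @ enc_nat v"

fun enc_sample :: "(nat \<times> nat) list \<times> bool \<Rightarrow> bool list" where
  "enc_sample (es, l) = l # enc_list enc_edge es"

fun enc_inst :: "inst \<Rightarrow> bool list" where
  "enc_inst (n, ss) = enc_nat n @ enc_list enc_sample ss"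

text \<open>A set of vertices is output as its characteristic vector.\<close>

fun enc_answer :: "nat \<Rightarrow> nat set option \<Rightarrow> bool list" where
  "enc_answer n None = [False]"
| "enc_answer n (Some X) = True # map (\<lambda>v. v \<in> X) [0..<n]"

definition solves_conscheck_2_coloring :: "tm \<Rightarrow> bool" where
  "solves_conscheck_2_coloring M \<longleftrightarrow>
     (\<forall>(n, ss) \<in> instances. \<exists>a. correct_answer {..<n} (samples ss) a \<and>
        outputs M (enc_inst (n, ss)) (enc_answer n a))"

end

theory Submission
  imports Defs
begin

text \<open>
  A negative sample says that some edge of its graph is monochromatic. With the positive sample
  \<open>{{0, 1}}\<close>, an edge from a vertex \<open>v\<close> to 0 (to 1) is therefore a positive (negative) literal, and a
  negative sample is a clause: consistency checking is CNF satisfiability. It remains to carry out the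
  Cook-Levin reduction on actual machines. A run of an NP machine is described relative to the heads,
  so that one step shifts each tape by at most one cell, and all clauses arise from finitely many
  templates by adding the lengths of a few unary tapes to the variable numbers. A deterministic
  machine prints these clauses in nested loops, runs the assumed solver on the resulting instance and
  accepts iff the first output bit is 1.
\<close>

section \<open>While programs and their compilation to Turing machines\<close>

text \<open>Every stage must be an actual machine with a proved time bound, and this shapes the
  choices. Vertex names are unary, so adding a register to a variable number means copying its
  marks. With the head at a fixed cell of every row, all other cells obey one template whose offset
  advances in a loop. The time bound of the NP machine is just some polynomial; a power
  \<open>(n + 2) ^ e\<close> above it can be computed by repeated addition, and existence of a run
  of exactly that length replaces acceptance. The clauses are one-sided: they force the true symbols
  of a run to be recorded, and a wrong transition is refuted only at the head cell. A row starts out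
  knowing \<open>T\<close> cells on either side of the head; ignorance moves inward by one cell per
  step, so the head cell stays known for all \<open>T\<close> steps. The solver is polynomial in the
  length of the printed instance, and that length is at most the running time of the reduction
  because a head moves at most one square per step.\<close>

datatype com =
    Skip
  | Accept
  | Basic "symbol list \<Rightarrow> (symbol \<times> dir) list"
  | Seq com com (infixr ";;" 60)
  | Cond "symbol list \<Rightarrow> bool" com com
  | While "symbol list \<Rightarrow> bool" com

text \<open>Every transition has to write and move; writing back what was read gives control steps
  that leave all tapes alone.\<close>

definition nop :: "symbol list \<Rightarrow> (symbol \<times> dir) list" where
  "nop rs = map (\<lambda>s. (s, Stay)) rs"

text \<open>Each test, and each passage from \<open>Skip ;; c\<close> to \<open>c\<close>, takes a
  step of its own; these are the small additive constants in the later time bounds.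
  \<open>Accept\<close> is stuck even in front of \<open>;;\<close>, so it is meant to end a
  program.\<close>

fun next_com :: "com \<Rightarrow> symbol list \<Rightarrow> (com \<times> (symbol \<times> dir) list) option" where
  "next_com Skip rs = None"
| "next_com Accept rs = None"
| "next_com (Basic f) rs = Some (Skip, f rs)"
| "next_com (c1 ;; c2) rs =
     (if c1 = Skip then Some (c2, nop rs)
      else map_option (\<lambda>(c, as). (c ;; c2, as)) (next_com c1 rs))"
| "next_com (Cond b c1 c2) rs = Some (if b rs then c1 else c2, nop rs)"
| "next_com (While b c) rs = Some (if b rs then c ;; While b c else Skip, nop rs)"

inductive cstep :: "com \<times> tape list \<Rightarrow> com \<times> tape list \<Rightarrow> bool" where
  "next_com c (map read_tape ts) = Some (c', as) \<Longrightarrow> cstep (c, ts) (c', map2 act as ts)"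

text \<open>The residuals of a command serve as the states of the compiled machine, with one machine step
  per \<open>cstep\<close>.\<close>

fun residuals :: "com \<Rightarrow> com set" where
  "residuals Skip = {Skip}"
| "residuals Accept = {Accept}"
| "residuals (Basic f) = {Basic f, Skip}"
| "residuals (c1 ;; c2) = (\<lambda>c. c ;; c2) ` residuals c1 \<union> residuals c2"
| "residuals (Cond b c1 c2) = {Cond b c1 c2} \<union> residuals c1 \<union> residuals c2"
| "residuals (While b c) = {While b c, Skip} \<union> (\<lambda>c'. c' ;; While b c) ` residuals c"

lemma finite_residuals: "finite (residuals c)"
  by (induction c) auto

lemma self_in_residuals: "c \<in> residuals c"
  by (induction c) auto

lemma residuals_closed:
  "c \<in> residuals c0 \<Longrightarrow> next_com c rs = Some (c', as) \<Longrightarrow> c' \<in> residuals c0"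
proof (induction c0 arbitrary: c c' as)
  case (Seq c1 c2)
  show ?case
  proof (cases "c \<in> residuals c2")
    case True
    then show ?thesis using Seq.IH(2) Seq.prems by auto
  next
    case False
    then obtain d where d: "d \<in> residuals c1" "c = d ;; c2" using Seq.prems by auto
    show ?thesis
    proof (cases "d = Skip")
      case True
      then show ?thesis using d Seq.prems self_in_residuals[of c2] by auto
    next
      case False
      then obtain d' as' where "next_com d rs = Some (d', as')" "c' = d' ;; c2"
        using d Seq.prems by auto
      then show ?thesis using Seq.IH(1)[OF d(1)] by auto
    qed
  qed
next
  case (Cond b c1 c2)
  consider "c = Cond b c1 c2" | "c \<in> residuals c1" | "c \<in> residuals c2" using Cond.prems by auto
  then show ?case
    by cases (use Cond self_in_residuals[of c1] self_in_residuals[of c2] in auto)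
next
  case (While b c1)
  consider "c = While b c1" | "c = Skip" | d where "d \<in> residuals c1" "c = d ;; While b c1"
    using While.prems by auto
  then show ?case
  proof cases
    case 1
    then show ?thesis using While.prems self_in_residuals[of c1] by auto
  next
    case 2
    then show ?thesis using While.prems by simp
  next
    case 3
    show ?thesis
    proof (cases "d = Skip")
      case True
      then show ?thesis using 3 While.prems by auto
    next
      case False
      then obtain d' as' where "next_com d rs = Some (d', as')" "c' = d' ;; While b c1"
        using 3 While.prems by auto
      then show ?thesis using While.IH[OF 3(1)] by auto
    qed
  qed
qed auto

text \<open>The alphabet \<open>G\<close> is what keeps the transition table of a compiled command finite.\<close>

fun wf_com :: "nat \<Rightarrow> symbol set \<Rightarrow> com \<Rightarrow> bool" where
  "wf_com k G (Basic f) \<longleftrightarrow>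
     (\<forall>rs. length rs = k \<and> set rs \<subseteq> G \<longrightarrow> length (f rs) = k \<and> fst ` set (f rs) \<subseteq> G)"
| "wf_com k G (c1 ;; c2) \<longleftrightarrow> wf_com k G c1 \<and> wf_com k G c2"
| "wf_com k G (Cond b c1 c2) \<longleftrightarrow> wf_com k G c1 \<and> wf_com k G c2"
| "wf_com k G (While b c) \<longleftrightarrow> wf_com k G c"
| "wf_com k G c \<longleftrightarrow> True"

section \<open>Tapes over a finite alphabet\<close>

definition tapes_over :: "nat \<Rightarrow> symbol set \<Rightarrow> tape list \<Rightarrow> bool" where
  "tapes_over k G ts \<longleftrightarrow> length ts = k \<and> (\<forall>t \<in> set ts. range (fst t) \<subseteq> G)"

lemma tapes_over_reads:
  "tapes_over k G ts \<Longrightarrow> length (map read_tape ts) = k \<and> set (map read_tape ts) \<subseteq> G"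
  by (force simp: tapes_over_def image_subset_iff)

lemma tapes_over_act:
  assumes "tapes_over k G ts" "length as = k" "fst ` set as \<subseteq> G"
  shows "tapes_over k G (map2 act as ts)"
proof -
  have "range (fst (act a t)) \<subseteq> G" if "(a, t) \<in> set (zip as ts)" for a t
  proof -
    obtain s d f i where [simp]: "a = (s, d)" "t = (f, i)" by (cases a, cases t)
    have "s \<in> G" using set_zip_leftD[OF that] assms(3) by force
    moreover have "range f \<subseteq> G" using set_zip_rightD[OF that] assms(1) by (force simp: tapes_over_def)
    ultimately show ?thesis by (auto simp: image_subset_iff)
  qed
  then have "\<forall>t \<in> set (map2 act as ts). range (fst t) \<subseteq> G" by fastforce
  then show ?thesis using assms by (simp add: tapes_over_def)
qed

lemma tapes_over_init:
  assumes "Blank \<in> G" "range Bit \<subseteq> G" "1 \<le> k"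
  shows "tapes_over k G (input_tape x # replicate (k - 1) blank_tape)"
  using assms by (auto simp: tapes_over_def input_tape_def blank_tape_def)

lemma wf_com_next:
  assumes "wf_com k G c" "next_com c rs = Some (c', as)" "length rs = k" "set rs \<subseteq> G"
  shows "wf_com k G c' \<and> length as = k \<and> fst ` set as \<subseteq> G"
  using assms(1,2)
proof (induction c arbitrary: c' as)
  case (Seq c1 c2)
  show ?case
  proof (cases "c1 = Skip")
    case True
    then show ?thesis using Seq.prems assms(3,4) by (auto simp: nop_def)
  next
    case False
    then obtain d where "next_com c1 rs = Some (d, as)" "c' = d ;; c2" using Seq.prems by auto
    then show ?thesis using Seq.IH(1)[of d as] Seq.prems(1) by simp
  qed
next
  case (Basic f)
  then have eqs: "c' = Skip" "as = f rs" by simp_all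
  have "length (f rs) = k \<and> fst ` set (f rs) \<subseteq> G"
    using Basic.prems(1)[unfolded wf_com.simps, rule_format, OF conjI, OF assms(3,4)] .
  then show ?case by (simp add: eqs)
next
  case (Cond b c1 c2)
  from Cond.prems show ?case using assms(3,4) by (cases "b rs") (auto simp: nop_def)
next
  case (While b c)
  from While.prems show ?case using assms(3,4) by (cases "b rs") (auto simp: nop_def)
qed simp_all

lemma deterministic_step_unique:
  "deterministic M \<Longrightarrow> step M c c1 \<Longrightarrow> step M c c2 \<Longrightarrow> c1 = c2"
  unfolding deterministic_def by (elim step.cases) blast

text \<open>For a functional relation, all runs from one start follow the same path. A single run
  into a dead end therefore settles the outcome and bounds the length of every other run.\<close>

lemma relpowp_stuck_unique:
  assumes "\<And>a b c. R a b \<Longrightarrow> R a c \<Longrightarrow> b = c"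
    and "(R ^^ n) a b" "\<nexists>b'. R b b'" "(R ^^ m) a c"
  shows "m \<le> n \<and> ((\<nexists>c'. R c c') \<longrightarrow> c = b)"
  using assms(2,4)
proof (induction n arbitrary: a m)
  case 0
  then have "m = 0" using assms(3) relpowp_Suc_D2[of _ R b c] by (cases m) auto
  then show ?case using 0 by simp
next
  case (Suc n)
  then obtain a' where a': "R a a'" "(R ^^ n) a' b" by (meson relpowp_Suc_D2)
  show ?case
  proof (cases m)
    case 0
    then show ?thesis using Suc.prems a' by auto
  next
    case (Suc m')
    then obtain a'' where "R a a''" "(R ^^ m') a'' c" using Suc.prems by (meson relpowp_Suc_D2)
    then have "(R ^^ m') a' c" using assms(1) a' by metis
    then show ?thesis using Suc.IH[OF a'(2)] Suc by simp
  qed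
qed

definition compile :: "nat \<Rightarrow> symbol set \<Rightarrow> com \<Rightarrow> (com \<Rightarrow> nat) \<Rightarrow> tm" where
  "compile k G c0 num = \<lparr>tapes = k, start = num c0, accepting = {num Accept},
     transitions = {(num c, rs, num c', as) | c rs c' as. c \<in> residuals c0 \<and> length rs = k \<and>
       set rs \<subseteq> G \<and> next_com c rs = Some (c', as)}\<rparr>"

text \<open>One machine \<open>D\<close> is obtained for all inputs. For each input it then suffices
  to exhibit one terminating \<open>cstep\<close> run, whose length is inherited as a time
  bound.\<close>

lemma compile_correct:
  assumes wf: "wf_com k G c0" and G: "finite G" "Blank \<in> G" "range Bit \<subseteq> G" and k: "1 \<le> k"
  shows "\<exists>D. wf_tm D \<and> deterministic D \<and>
    (\<forall>x n c ts. (cstep ^^ n) (c0, input_tape x # replicate (k - 1) blank_tape) (c, ts)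
        \<and> c \<in> {Skip, Accept} \<longrightarrow>
      (accepts D x \<longleftrightarrow> c = Accept) \<and> (\<forall>m d. (step D ^^ m) (init D x) d \<longrightarrow> m \<le> n))"
proof -
  have wf_res: "c \<in> residuals c0 \<Longrightarrow> wf_com k G c" for c
    using wf by (induction c0 arbitrary: c) auto
  \<comment> \<open>\<open>Accept\<close> is inserted so that the accepting state
    \<open>num Accept\<close> differs from the numbers of all other residuals, even if
    \<open>Accept\<close> is not a residual itself.\<close>
  obtain num :: "com \<Rightarrow> nat" where num: "inj_on num (insert Accept (residuals c0))"
    using finite_imp_inj_to_nat_seg[of "insert Accept (residuals c0)"] finite_residuals by auto
  define D where "D = compile k G c0 num"
  have trans_D: "transitions D = {(num c, rs, num c', as) | c rs c' as. c \<in> residuals c0 \<and>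
      length rs = k \<and> set rs \<subseteq> G \<and> next_com c rs = Some (c', as)}"
    by (simp add: D_def compile_def)
  have "transitions D \<subseteq> (\<lambda>(c, rs). case next_com c rs of None \<Rightarrow> undefined
      | Some (c', as) \<Rightarrow> (num c, rs, num c', as)) ` (residuals c0 \<times> {rs. set rs \<subseteq> G \<and> length rs = k})"
    unfolding trans_D by (auto intro!: rev_image_eqI)
  then have fin: "finite (transitions D)"
    by (rule finite_subset)
      (intro finite_imageI finite_cartesian_product finite_residuals finite_lists_length_eq G(1))
  have wfD: "wf_tm D"
  proof -
    have "length rs = k \<and> length as = k" if "(q, rs, q', as) \<in> transitions D" for q rs q' as
      using that wf_com_next[OF wf_res] by (auto simp: trans_D)
    then show ?thesis using fin k unfolding wf_tm_def by (auto simp: D_def compile_def)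
  qed
  have detD: "deterministic D"
    unfolding deterministic_def
  proof (intro allI impI, elim conjE)
    fix q rs q1 as1 q2 as2
    assume "(q, rs, q1, as1) \<in> transitions D" "(q, rs, q2, as2) \<in> transitions D"
    then obtain c1 d1 c2 d2 where c: "c1 \<in> residuals c0" "c2 \<in> residuals c0" "num c1 = num c2"
      "next_com c1 rs = Some (d1, as1)" "next_com c2 rs = Some (d2, as2)" "q1 = num d1" "q2 = num d2"
      unfolding trans_D by auto
    then have "c1 = c2" using num by (simp add: inj_on_def)
    then show "q1 = q2 \<and> as1 = as2" using c by simp
  qed
  \<comment> \<open>The alphabet has to be part of the invariant, since the transition table lists
    only readings over \<open>G\<close>.\<close>
  have sim: "(step D ^^ n) (num c0, ts0) (num c, ts) \<and> c \<in> residuals c0 \<and> tapes_over k G ts"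
    if "(cstep ^^ n) (c0, ts0) (c, ts)" "tapes_over k G ts0" for n c ts ts0
    using that
  proof (induction n arbitrary: c ts)
    case 0
    then show ?case by (simp add: self_in_residuals)
  next
    case (Suc n)
    then obtain c1 ts1 where "(cstep ^^ n) (c0, ts0) (c1, ts1)" and st: "cstep (c1, ts1) (c, ts)"
      by auto
    then have IH: "(step D ^^ n) (num c0, ts0) (num c1, ts1)" "c1 \<in> residuals c0" "tapes_over k G ts1"
      using Suc by auto
    from st obtain as where as: "next_com c1 (map read_tape ts1) = Some (c, as)" "ts = map2 act as ts1"
      by (auto elim: cstep.cases)
    note rd = tapes_over_reads[OF IH(3)]
    have "step D (num c1, ts1) (num c, ts)"
      unfolding as(2) by (rule step.intros) (use as IH rd in \<open>auto simp: trans_D\<close>)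
    moreover have "tapes_over k G ts"
      using wf_com_next[OF wf_res[OF IH(2)] as(1)] rd tapes_over_act[OF IH(3)] as(2) by auto
    moreover have "c \<in> residuals c0" using residuals_closed[OF IH(2) as(1)] .
    ultimately show ?case using IH(1) by auto
  qed
  have "(accepts D x \<longleftrightarrow> c = Accept) \<and> (\<forall>m d. (step D ^^ m) (init D x) d \<longrightarrow> m \<le> n)"
    if run: "(cstep ^^ n) (c0, input_tape x # replicate (k - 1) blank_tape) (c, ts)"
      and c: "c \<in> {Skip, Accept}" for x n c ts
  proof -
    have S: "(step D ^^ n) (init D x) (num c, ts)" "c \<in> residuals c0"
      using sim[OF run tapes_over_init[OF G(2,3) k]] by (auto simp: init_def D_def compile_def)
    have stuck: "\<nexists>d. step D (num c, ts) d"
    proof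
      assume "\<exists>d. step D (num c, ts) d"
      then obtain c' as c'' where "c' \<in> residuals c0" "num c = num c'"
        "next_com c' (map read_tape ts) = Some (c'', as)"
        by (auto elim!: step.cases simp: trans_D)
      then show False using num S(2) c by (auto dest!: inj_onD)
    qed
    have U: "m \<le> n \<and> ((\<nexists>d'. step D d d') \<longrightarrow> d = (num c, ts))"
      if "(step D ^^ m) (init D x) d" for m d
      using relpowp_stuck_unique[OF _ S(1) stuck that] deterministic_step_unique[OF detD] by blast
    have "halts_with D x d \<longleftrightarrow> d = (num c, ts)" for d
    proof
      assume "halts_with D x d"
      then obtain m where "(step D ^^ m) (init D x) d" "\<nexists>d'. step D d d'"
        unfolding halts_with_def halted_def by (auto dest: rtranclp_imp_relpowp)
      then show "d = (num c, ts)" using U by blast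
    next
      assume "d = (num c, ts)"
      then show "halts_with D x d"
        using relpowp_imp_rtranclp[OF S(1)] stuck by (simp add: halts_with_def halted_def)
    qed
    then have "accepts D x \<longleftrightarrow> num c \<in> accepting D" by (simp add: accepts_def)
    also have "\<dots> \<longleftrightarrow> c = Accept"
      using num S(2) by (auto simp: D_def compile_def inj_on_def)
    finally show ?thesis using U by blast
  qed
  note main = this
  show ?thesis by (intro exI[of _ D] conjI[OF wfD] conjI[OF detD] allI impI) (elim conjE, rule main)
qed

section \<open>Timed executions of commands\<close>

definition runs :: "com \<Rightarrow> tape list \<Rightarrow> nat \<Rightarrow> tape list \<Rightarrow> bool" where
  "runs c ts T ts' \<longleftrightarrow> (\<exists>n\<le>T. (cstep ^^ n) (c, ts) (Skip, ts'))"

lemma map2_act_nop: "map2 act (nop (map read_tape ts)) ts = ts"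
  by (induction ts) (auto simp: nop_def)

lemma cstep_nop:
  assumes "next_com c (map read_tape ts) = Some (c', nop (map read_tape ts))"
  shows "cstep (c, ts) (c', ts)"
  using cstep.intros[OF assms] by (simp add: map2_act_nop)

lemma cstep_Seq: "cstep (c, ts) (c', ts') \<Longrightarrow> cstep (c ;; d, ts) (c' ;; d, ts')"
  by (auto elim!: cstep.cases intro!: cstep.intros)

lemma relpowp_cstep_Seq:
  "(cstep ^^ n) (c, ts) (c', ts') \<Longrightarrow> (cstep ^^ n) (c ;; d, ts) (c' ;; d, ts')"
  by (induction n arbitrary: c' ts') (auto dest: cstep_Seq)

lemma relpowp_Seq:
  assumes "(cstep ^^ n) (c, ts) (Skip, ts')" "(cstep ^^ m) (d, ts') e"
  shows "(cstep ^^ (n + m + 1)) (c ;; d, ts) e"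
proof -
  have "cstep (Skip ;; d, ts') (d, ts')" by (rule cstep_nop) simp
  then have "(cstep ^^ Suc m) (Skip ;; d, ts') e" using assms(2) by (rule relpowp_Suc_I2)
  with relpowp_cstep_Seq[OF assms(1)] have "((cstep ^^ n) OO (cstep ^^ Suc m)) (c ;; d, ts) e" by blast
  then show ?thesis by (simp add: relpowp_add[symmetric] del: relpowp.simps)
qed

lemma runs_mono: "runs c ts T ts' \<Longrightarrow> T \<le> T' \<Longrightarrow> runs c ts T' ts'"
  unfolding runs_def by (meson order_trans)

lemma runs_Seq:
  "runs c ts T1 ts1 \<Longrightarrow> runs d ts1 T2 ts2 \<Longrightarrow> runs (c ;; d) ts (T1 + T2 + 1) ts2"
  unfolding runs_def by (meson relpowp_Seq add_le_mono le_refl)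

lemma runs_Skip: "runs Skip ts 0 ts"
  by (auto simp: runs_def)

lemma runs_Basic: "runs (Basic f) ts 1 (map2 act (f (map read_tape ts)) ts)"
  unfolding runs_def by (intro exI[of _ 1]) (simp add: cstep.intros relpowp_1 del: relpowp.simps)

lemma runs_step:
  assumes "cstep (c, ts) (c', ts)" "runs c' ts T ts'"
  shows "runs c ts (T + 1) ts'"
  using assms unfolding runs_def
  by (metis Suc_eq_plus1 add_le_mono1 relpowp_Suc_I2)

lemma runs_Cond:
  assumes "runs (if b (map read_tape ts) then c else d) ts T ts'"
  shows "runs (Cond b c d) ts (T + 1) ts'"
  by (rule runs_step[OF cstep_nop assms]) simp

text \<open>Each round pays for the test, the body and the step that drops the leading
  \<open>Skip\<close>, whence \<open>T + 2\<close>; the final \<open>+ 1\<close> is the failing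
  test.\<close>

lemma runs_While:
  assumes "\<And>i. i < n \<Longrightarrow> b (map read_tape (St i)) \<and> runs c (St i) T (St (Suc i))"
    and "\<not> b (map read_tape (St n))"
  shows "runs (While b c) (St 0) (n * (T + 2) + 1) (St n)"
  using assms
proof (induction n arbitrary: St)
  case 0
  then show ?case using runs_step[OF cstep_nop runs_Skip] by simp
next
  case (Suc n)
  have "runs (While b c) (St (Suc 0)) (n * (T + 2) + 1) (St (Suc n))"
    using Suc.IH[of "\<lambda>i. St (Suc i)"] Suc.prems by auto
  then have "runs (c ;; While b c) (St 0) (T + (n * (T + 2) + 1) + 1) (St (Suc n))"
    using Suc.prems(1)[of 0] by (intro runs_Seq) auto
  then have "runs (While b c) (St 0) (T + (n * (T + 2) + 1) + 1 + 1) (St (Suc n))"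
    using Suc.prems(1)[of 0] by (elim runs_step[OF cstep_nop, rotated]) simp
  then show ?case by (rule runs_mono) simp
qed

section \<open>Programs that print clauses\<close>

text \<open>Words start at square 0 with blanks on both sides: \<open>Walk\<close> stops at the
  blank behind the word, \<open>Rewind\<close> at the blank on square -1.\<close>

fun tape_of :: "symbol list \<times> int \<Rightarrow> tape" where
  "tape_of (w, i) = (\<lambda>k. if 0 \<le> k \<and> k < int (length w) then w ! nat k else Blank, i)"

definition tapes_of :: "nat \<Rightarrow> (nat \<Rightarrow> symbol list \<times> int) \<Rightarrow> tape list" where
  "tapes_of k \<sigma> = map (\<lambda>j. tape_of (\<sigma> j)) [0..<k]"

lemma read_tapes_of: "j < k \<Longrightarrow> map read_tape (tapes_of k \<sigma>) ! j = read_tape (tape_of (\<sigma> j))"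
  by (simp add: tapes_of_def)

definition Act :: "nat \<Rightarrow> (symbol \<Rightarrow> symbol \<times> dir) \<Rightarrow> com" where
  "Act j g = Basic (\<lambda>rs. map (\<lambda>i. if i = j then g (rs ! i) else (rs ! i, Stay)) [0..<length rs])"

lemma act_read_Stay: "act (read_tape t, Stay) t = t"
  by (cases t) simp

lemma runs_Act:
  assumes "j < k" "act (g (read_tape (tape_of (\<sigma> j)))) (tape_of (\<sigma> j)) = tape_of v"
  shows "runs (Act j g) (tapes_of k \<sigma>) 1 (tapes_of k (\<sigma>(j := v)))"
proof -
  have "map2 act (map (\<lambda>i. if i = j then g (map read_tape (tapes_of k \<sigma>) ! i)
      else (map read_tape (tapes_of k \<sigma>) ! i, Stay)) [0..<length (map read_tape (tapes_of k \<sigma>))])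
      (tapes_of k \<sigma>) = tapes_of k (\<sigma>(j := v))"
    by (rule nth_equalityI) (use assms in \<open>auto simp: tapes_of_def act_read_Stay\<close>)
  then show ?thesis
    using runs_Basic[of "\<lambda>rs. map (\<lambda>i. if i = j then g (rs ! i) else (rs ! i, Stay)) [0..<length rs]"
        "tapes_of k \<sigma>"]
    by (simp only: Act_def)
qed

lemma wf_com_Act: "(\<And>s. s \<in> G \<Longrightarrow> fst (g s) \<in> G) \<Longrightarrow> wf_com k G (Act j g)"
  by (force simp: Act_def set_conv_nth image_subset_iff subset_iff)

text \<open>A for loop whose counter is the word on tape \<open>j\<close>: the head position is the
  number of the current round.\<close>

definition Walk :: "nat \<Rightarrow> com \<Rightarrow> com" where
  "Walk j c = While (\<lambda>rs. rs ! j \<noteq> Blank) (c ;; Act j (\<lambda>s. (s, Rgt)))"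

text \<open>The first move leaves the blank on which a completed \<open>Walk\<close> ends; the last
  one returns from the blank on square -1.\<close>

definition Rewind :: "nat \<Rightarrow> com" where
  "Rewind j = Act j (\<lambda>s. (s, Lft)) ;; While (\<lambda>rs. rs ! j \<noteq> Blank) (Act j (\<lambda>s. (s, Lft))) ;;
     Act j (\<lambda>s. (s, Rgt))"

fun put :: "nat \<Rightarrow> bool list \<Rightarrow> com" where
  "put j [] = Skip"
| "put j (b # bs) = Act j (\<lambda>_. (Bit b, Rgt)) ;; put j bs"

definition add_tape :: "nat \<Rightarrow> nat \<Rightarrow> com" where
  "add_tape i j = Rewind i ;; Walk i (put j [True])"

text \<open>The head waits on the first blank behind the word, ready to append; \<open>un\<close>
  keeps unary registers in the same position.\<close>

definition str :: "bool list \<Rightarrow> symbol list \<times> int" where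
  "str w = (map Bit w, int (length w))"

definition un :: "nat \<Rightarrow> symbol list \<times> int" where
  "un a = (replicate a (Bit True), int a)"

lemma un_str: "un a = str (replicate a True)"
  by (simp add: un_def str_def)

lemma wf_com_Walk: "wf_com k G c \<Longrightarrow> wf_com k G (Walk j c)"
  by (simp add: Walk_def wf_com_Act)

lemma wf_com_Rewind: "wf_com k G (Rewind j)"
  by (simp add: Rewind_def wf_com_Act)

lemma wf_com_put: "range Bit \<subseteq> G \<Longrightarrow> wf_com k G (put j bs)"
  by (induction bs) (auto intro!: wf_com_Act)

lemma wf_com_add_tape: "range Bit \<subseteq> G \<Longrightarrow> wf_com k G (add_tape i j)"
  by (simp add: add_tape_def wf_com_Walk wf_com_Rewind wf_com_put del: put.simps)

lemma act_move: "act (read_tape (tape_of (w, i)), d) (tape_of (w, i)) = tape_of (w, move d i)"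
  by auto

lemma runs_Rewind:
  assumes j: "j < k" and w: "Blank \<notin> set w" and i: "i \<le> length w" and \<sigma>: "\<sigma> j = (w, int i)"
  shows "runs (Rewind j) (tapes_of k \<sigma>) (3 * i + 5) (tapes_of k (\<sigma>(j := (w, 0))))"
proof -
  define St where "St m = \<sigma>(j := (w, int i - 1 - int m))" for m
  have 1: "runs (Act j (\<lambda>s. (s, Lft))) (tapes_of k \<sigma>) 1 (tapes_of k (St 0))"
    unfolding St_def by (rule runs_Act[OF j]) (simp only: \<sigma> act_move, simp)
  have 2: "runs (While (\<lambda>rs. rs ! j \<noteq> Blank) (Act j (\<lambda>s. (s, Lft)))) (tapes_of k (St 0))
      (i * (1 + 2) + 1) (tapes_of k (St i))"
  proof (rule runs_While[where St = "\<lambda>m. tapes_of k (St m)"])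
    fix m assume m: "m < i"
    have "runs (Act j (\<lambda>s. (s, Lft))) (tapes_of k (St m)) 1
        (tapes_of k ((St m)(j := (w, int i - 1 - int m - 1))))"
      by (rule runs_Act[OF j]) (simp only: St_def fun_upd_same act_move, simp)
    moreover have "(St m)(j := (w, int i - 1 - int m - 1)) = St (Suc m)"
      by (simp add: St_def)
    moreover have "nat (int i - 1 - int m) < length w" using i m by simp
    then have "w ! nat (int i - 1 - int m) \<noteq> Blank" using w nth_mem by metis
    ultimately show "map read_tape (tapes_of k (St m)) ! j \<noteq> Blank \<and>
        runs (Act j (\<lambda>s. (s, Lft))) (tapes_of k (St m)) 1 (tapes_of k (St (Suc m)))"
      using i m by (simp add: read_tapes_of[OF j] St_def)
  qed (simp add: read_tapes_of[OF j] St_def)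
  have 3: "runs (Act j (\<lambda>s. (s, Rgt))) (tapes_of k (St i)) 1 (tapes_of k ((St i)(j := (w, 0))))"
    by (rule runs_Act[OF j]) (simp only: St_def fun_upd_same act_move, simp)
  have "(St i)(j := (w, 0)) = \<sigma>(j := (w, 0))" by (simp add: St_def)
  then show ?thesis
    unfolding Rewind_def using runs_mono[OF runs_Seq[OF 1 runs_Seq[OF 2 3]]] by simp
qed

lemma runs_put:
  assumes "j < k" "\<sigma> j = str w"
  shows "runs (put j bs) (tapes_of k \<sigma>) (2 * length bs) (tapes_of k (\<sigma>(j := str (w @ bs))))"
  using assms(2)
proof (induction bs arbitrary: \<sigma> w)
  case Nil
  then have "\<sigma>(j := str (w @ [])) = \<sigma>" by (simp add: fun_upd_idem)
  then show ?case using runs_Skip by simp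
next
  case (Cons b bs)
  have "runs (Act j (\<lambda>_. (Bit b, Rgt))) (tapes_of k \<sigma>) 1 (tapes_of k (\<sigma>(j := str (w @ [b]))))"
    by (rule runs_Act[OF assms(1)])
      (auto simp: Cons.prems str_def fun_eq_iff nth_append nat_less_iff)
  moreover have "runs (put j bs) (tapes_of k (\<sigma>(j := str (w @ [b])))) (2 * length bs)
      (tapes_of k (\<sigma>(j := str (w @ b # bs))))"
    using Cons.IH[of "\<sigma>(j := str (w @ [b]))" "w @ [b]"]
    by (simp only: fun_upd_same fun_upd_upd append.assoc append.simps simp_thms)
  ultimately have "runs (put j (b # bs)) (tapes_of k \<sigma>) (1 + 2 * length bs + 1)
      (tapes_of k (\<sigma>(j := str (w @ b # bs))))"
    unfolding put.simps by (rule runs_Seq)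
  moreover have "1 + 2 * length bs + 1 = 2 * length (b # bs)" by simp
  ultimately show ?case by (simp only:)
qed

text \<open>A literal template \<open>(s, js, a)\<close> stands for the literal of sign \<open>s\<close> whose variable is \<open>a\<close> plus the
  lengths of the unary tapes \<open>js\<close>. In the coloring instance a literal is the edge joining its
  variable to vertex 0 (positive) or vertex 1 (negative); it holds iff that edge is monochromatic.\<close>

definition lit_edge :: "bool \<times> nat \<Rightarrow> nat \<times> nat" where
  "lit_edge l = (if fst l then 0 else 1, snd l)"

definition clause_sample :: "(bool \<times> nat) list \<Rightarrow> (nat \<times> nat) list \<times> bool" where
  "clause_sample cl = (map lit_edge cl, False)"

definition enc_clauses :: "(bool \<times> nat) list list \<Rightarrow> bool list" where
  "enc_clauses cls = concat (map (\<lambda>cl. True # enc_sample (clause_sample cl)) cls)"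

type_synonym template = "bool \<times> nat list \<times> nat"

fun inst_lit :: "(nat \<Rightarrow> nat) \<Rightarrow> template \<Rightarrow> bool \<times> nat" where
  "inst_lit len (s, js, a) = (s, sum_list (map len js) + a)"

definition inst_clauses :: "(nat \<Rightarrow> nat) \<Rightarrow> template list list \<Rightarrow> (bool \<times> nat) list list" where
  "inst_clauses len cls = map (map (inst_lit len)) cls"

text \<open>This and the next two functions count steps per unit of \<open>Z + 1\<close>, where
  \<open>Z\<close> bounds the unary tapes; the constants are generous roundings.\<close>

fun lit_cost :: "template \<Rightarrow> nat" where
  "lit_cost (s, js, a) = 10 * length js + 2 * a + 20"

definition clause_cost :: "template list \<Rightarrow> nat" where
  "clause_cost ls = sum_list (map (\<lambda>l. lit_cost l + 1) ls) + 10"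

definition clauses_cost :: "template list list \<Rightarrow> nat" where
  "clauses_cost cls = sum_list (map (\<lambda>cl. clause_cost cl + 1) cls)"

definition template_tapes :: "template list list \<Rightarrow> nat set" where
  "template_tapes cls = (\<Union>cl \<in> set cls. \<Union>(s, js, a) \<in> set cl. set js)"

section \<open>Programs that append to one output tape\<close>

locale printer =
  fixes k out :: nat
  assumes out: "out < k"
begin

text \<open>\<open>gen c \<sigma> T bs \<sigma>'\<close>: within \<open>T\<close> steps, \<open>c\<close> appends \<open>bs\<close> to whatever is on tape \<open>out\<close> and turns
  \<open>\<sigma>\<close> into \<open>\<sigma>'\<close> on the other tapes; the values of \<open>\<sigma>\<close> and \<open>\<sigma>'\<close> at \<open>out\<close> are irrelevant.\<close>

definition gen :: "com \<Rightarrow> (nat \<Rightarrow> symbol list \<times> int) \<Rightarrow> nat \<Rightarrow> bool list \<Rightarrow>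
    (nat \<Rightarrow> symbol list \<times> int) \<Rightarrow> bool" where
  "gen c \<sigma> T bs \<sigma>' \<longleftrightarrow>
     (\<forall>w. runs c (tapes_of k (\<sigma>(out := str w))) T (tapes_of k (\<sigma>'(out := str (w @ bs)))))"

lemma gen_mono: "gen c \<sigma> T bs \<sigma>' \<Longrightarrow> T \<le> T' \<Longrightarrow> gen c \<sigma> T' bs \<sigma>'"
  unfolding gen_def using runs_mono by blast

lemma gen_weaken:
  "gen c \<sigma> T bs \<sigma>' \<Longrightarrow> T \<le> T' \<Longrightarrow> bs = bs' \<Longrightarrow> \<sigma>' = \<sigma>'' \<Longrightarrow> gen c \<sigma> T' bs' \<sigma>''"
  using gen_mono by blast

lemma gen_Skip: "gen Skip \<sigma> T [] \<sigma>"
  unfolding gen_def by (auto intro: runs_mono[OF runs_Skip])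

lemma gen_Seq:
  "gen c1 \<sigma> T1 bs1 \<sigma>1 \<Longrightarrow> gen c2 \<sigma>1 T2 bs2 \<sigma>2 \<Longrightarrow> gen (c1 ;; c2) \<sigma> (T1 + T2 + 1) (bs1 @ bs2) \<sigma>2"
  unfolding gen_def using runs_Seq by (metis append.assoc)

lemma gen_Cond:
  assumes j: "j < k" "j \<noteq> out"
    and "gen (if read_tape (tape_of (\<sigma> j)) = s then c else d) \<sigma> T bs \<sigma>'"
  shows "gen (Cond (\<lambda>rs. rs ! j = s) c d) \<sigma> (T + 1) bs \<sigma>'"
  unfolding gen_def
proof (intro allI runs_Cond)
  fix w
  show "runs (if map read_tape (tapes_of k (\<sigma>(out := str w))) ! j = s then c else d)
      (tapes_of k (\<sigma>(out := str w))) T (tapes_of k (\<sigma>'(out := str (w @ bs))))"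
    using assms(3) j by (auto simp: gen_def read_tapes_of split: if_splits)
qed

lemma gen_Act:
  assumes j: "j < k" "j \<noteq> out"
    and "act (g (read_tape (tape_of (\<sigma> j)))) (tape_of (\<sigma> j)) = tape_of v"
  shows "gen (Act j g) \<sigma> 1 [] (\<sigma>(j := v))"
  unfolding gen_def
proof
  fix w
  show "runs (Act j g) (tapes_of k (\<sigma>(out := str w))) 1 (tapes_of k ((\<sigma>(j := v))(out := str (w @ []))))"
    using runs_Act[of j k g "\<sigma>(out := str w)" v] assms by (simp add: fun_upd_twist)
qed

lemma gen_Rewind:
  assumes "j < k" "j \<noteq> out" "Blank \<notin> set w" "i \<le> length w" "\<sigma> j = (w, int i)"
  shows "gen (Rewind j) \<sigma> (3 * i + 5) [] (\<sigma>(j := (w, 0)))"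
  unfolding gen_def
proof
  fix v
  show "runs (Rewind j) (tapes_of k (\<sigma>(out := str v))) (3 * i + 5)
      (tapes_of k ((\<sigma>(j := (w, 0)))(out := str (v @ []))))"
    using runs_Rewind[of j k w i "\<sigma>(out := str v)"] assms by (simp add: fun_upd_twist)
qed

lemma gen_print: "gen (put out bs) \<sigma> (2 * length bs) bs \<sigma>"
  unfolding gen_def
proof
  fix w
  show "runs (put out bs) (tapes_of k (\<sigma>(out := str w))) (2 * length bs)
      (tapes_of k (\<sigma>(out := str (w @ bs))))"
    using runs_put[OF out, of "\<sigma>(out := str w)" w bs] by simp
qed

lemma gen_grow:
  assumes "j < k" "j \<noteq> out" "\<sigma> j = un b"
  shows "gen (put j (replicate a True)) \<sigma> (2 * a) [] (\<sigma>(j := un (b + a)))"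
  unfolding gen_def
proof
  fix w
  show "runs (put j (replicate a True)) (tapes_of k (\<sigma>(out := str w))) (2 * a)
      (tapes_of k ((\<sigma>(j := un (b + a)))(out := str (w @ []))))"
    using runs_put[of j k "\<sigma>(out := str w)" "replicate b True" "replicate a True"] assms
    by (simp add: fun_upd_twist un_str replicate_add)
qed

text \<open>\<open>St i\<close> is the state before round \<open>i\<close>. The body must hand back
  the counter with its head still on square \<open>i\<close>; the closing move to the right then
  produces \<open>St (Suc i)\<close>.\<close>

lemma gen_Walk:
  assumes j: "j < k" "j \<noteq> out" and w: "Blank \<notin> set w" "length w = n"
    and pos: "\<And>i. i \<le> n \<Longrightarrow> St i j = (w, int i)"
    and body: "\<And>i. i < n \<Longrightarrow> gen c (St i) T (bs i) ((St (Suc i))(j := (w, int i)))"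
  shows "gen (Walk j c) (St 0) (n * (T + 4) + 1) (concat (map bs [0..<n])) (St n)"
  unfolding gen_def Walk_def
proof
  fix v
  define St' where "St' i = tapes_of k ((St i)(out := str (v @ concat (map bs [0..<i]))))" for i
  let ?b = "\<lambda>rs. rs ! j \<noteq> Blank"
  let ?c = "c ;; Act j (\<lambda>s. (s, Rgt))"
  have "runs (While ?b ?c) (St' 0) (n * ((T + 2) + 2) + 1) (St' n)"
  proof (rule runs_While)
    fix i assume i: "i < n"
    have "?b (map read_tape (St' i))"
      using j pos[of i] w i nth_mem[of i w] by (auto simp: St'_def read_tapes_of simp del: nth_mem)
    moreover have "gen (Act j (\<lambda>s. (s, Rgt))) ((St (Suc i))(j := (w, int i))) 1 []
        ((St (Suc i))(j := (w, int i), j := (w, int (Suc i))))"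
      by (rule gen_Act[OF j]) (simp only: fun_upd_same act_move, simp)
    then have "gen (Act j (\<lambda>s. (s, Rgt))) ((St (Suc i))(j := (w, int i))) 1 [] (St (Suc i))"
      using pos[of "Suc i"] i by (simp add: fun_upd_idem)
    from gen_Seq[OF body[OF i] this] have "runs ?c (St' i) (T + 2) (St' (Suc i))"
      by (auto simp: gen_def St'_def dest!: spec[of _ "v @ concat (map bs [0..<i])"])
    ultimately show "?b (map read_tape (St' i)) \<and> runs ?c (St' i) (T + 2) (St' (Suc i))" by blast
  next
    show "\<not> ?b (map read_tape (St' n))"
      using j pos[of n] w by (simp add: St'_def read_tapes_of)
  qed
  then have "runs (While ?b ?c) (St' 0) (n * (T + 4) + 1) (St' n)"
    by (rule runs_mono) (simp add: algebra_simps)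
  then show "runs (While ?b ?c) (tapes_of k ((St 0)(out := str v))) (n * (T + 4) + 1)
      (tapes_of k ((St n)(out := str (v @ concat (map bs [0..<n])))))"
    by (simp add: St'_def)
qed

text \<open>As the body has to work for an arbitrary counter value \<rho>, the family
  \<open>St\<close> describes only the tapes other than the counter.\<close>

lemma gen_Walk_un:
  assumes j: "j < k" "j \<noteq> out" "\<sigma> j = (replicate a (Bit True), 0)"
    and body: "\<And>i \<rho>. i < a \<Longrightarrow> gen c ((St i)(j := \<rho>)) T (bs i) ((St (Suc i))(j := \<rho>))"
    and St0: "\<And>i. i \<noteq> j \<Longrightarrow> St 0 i = \<sigma> i"
  shows "gen (Walk j c) \<sigma> (a * (T + 4) + 1) (concat (map bs [0..<a])) ((St a)(j := un a))"
proof -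
  define St' where "St' i = (St i)(j := (replicate a (Bit True), int i))" for i
  have "gen (Walk j c) (St' 0) (a * (T + 4) + 1) (concat (map bs [0..<a])) (St' a)"
  proof (rule gen_Walk[OF j(1,2), where w = "replicate a (Bit True)"])
    fix i assume "i < a"
    from body[OF this, of "(replicate a (Bit True), int i)"]
    show "gen c (St' i) T (bs i) ((St' (Suc i))(j := (replicate a (Bit True), int i)))"
      by (simp only: St'_def fun_upd_upd)
  qed (simp_all add: St'_def)
  moreover have "St' 0 = \<sigma>" using assms by (auto simp: St'_def)
  ultimately show ?thesis by (simp add: un_def St'_def)
qed

lemma gen_print_tape:
  assumes i: "i < k" "i \<noteq> out" "\<sigma> i = un a"
  shows "gen (add_tape i out) \<sigma> (9 * a + 7) (replicate a True) \<sigma>"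
proof -
  have "gen (Walk i (put out [True])) (\<sigma>(i := (replicate a (Bit True), 0))) (a * (2 + 4) + 1)
      (concat (map (\<lambda>_. [True]) [0..<a])) (((\<lambda>_. \<sigma>) a)(i := un a))"
    by (rule gen_Walk_un) (use i gen_print[of "[True]"] in auto)
  from gen_Seq[OF gen_Rewind[OF i(1,2), of "replicate a (Bit True)" a] this]
  have "gen (add_tape i out) \<sigma> (3 * a + 5 + (a * (2 + 4) + 1) + 1)
      ([] @ concat (map (\<lambda>_. [True]) [0..<a])) (\<sigma>(i := un a))"
    using i(3) by (simp add: add_tape_def un_def)
  then show ?thesis
    by (rule gen_weaken) (use i(3) in \<open>auto simp: fun_upd_idem map_replicate_trivial\<close>)
qed

lemma gen_add_tape:
  assumes i: "i < k" "i \<noteq> out" "\<sigma> i = un a" and j: "j < k" "j \<noteq> out" "\<sigma> j = un b" "j \<noteq> i"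
  shows "gen (add_tape i j) \<sigma> (9 * a + 7) [] (\<sigma>(j := un (b + a)))"
proof -
  have "gen (Walk i (put j [True])) (\<sigma>(i := (replicate a (Bit True), 0))) (a * (2 + 4) + 1)
      (concat (map (\<lambda>_. []) [0..<a])) ((\<sigma>(j := un (b + a)))(i := un a))"
  proof (rule gen_Walk_un[where St = "\<lambda>m. \<sigma>(j := un (b + m))"])
    fix m \<rho>
    show "gen (put j [True]) (\<sigma>(j := un (b + m), i := \<rho>)) 2 [] (\<sigma>(j := un (b + Suc m), i := \<rho>))"
      using gen_grow[of j "\<sigma>(j := un (b + m), i := \<rho>)" "b + m" 1] i j
      by (simp add: fun_upd_twist del: put.simps)
  qed (use i j in auto)
  from gen_Seq[OF gen_Rewind[OF i(1,2), of "replicate a (Bit True)" a] this]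
  have "gen (add_tape i j) \<sigma> (3 * a + 5 + (a * (2 + 4) + 1) + 1)
      ([] @ concat (map (\<lambda>_. []) [0..<a])) (\<sigma>(j := un (b + a), i := un a))"
    using i(3) by (simp add: add_tape_def un_def)
  then show ?thesis
    by (rule gen_weaken) (use i j in \<open>auto simp: fun_upd_idem fun_upd_twist\<close>)
qed

fun print_tapes :: "nat list \<Rightarrow> com" where
  "print_tapes [] = Skip"
| "print_tapes (j # js) = add_tape j out ;; print_tapes js"

text \<open>In unary, addition is concatenation: the marks of the tapes \<open>js\<close> followed
  by \<open>enc_nat a\<close> form the code of the sum. The leading \<open>True\<close> is the mark
  by which \<open>enc_list\<close> announces a further entry.\<close>

fun print_lit :: "template \<Rightarrow> com" where
  "print_lit (s, js, a) =
     put out (True # enc_nat (if s then 0 else 1)) ;; print_tapes js ;; put out (enc_nat a)"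

text \<open>The first \<open>True\<close> announces another sample, the \<open>False\<close> after
  it is the label of that sample, and the last \<open>False\<close> closes its edge list.\<close>

definition print_clause :: "template list \<Rightarrow> com" where
  "print_clause ls =
     put out [True, False] ;; foldr (\<lambda>l c. print_lit l ;; c) ls (put out [False])"

definition print_clauses :: "template list list \<Rightarrow> com" where
  "print_clauses cls = foldr (\<lambda>ls c. print_clause ls ;; c) cls Skip"

lemma wf_com_print_clauses: "range Bit \<subseteq> G \<Longrightarrow> wf_com k G (print_clauses cls)"
proof -
  assume G: "range Bit \<subseteq> G"
  have 1: "wf_com k G (print_tapes js)" for js
    by (induction js) (auto simp: wf_com_add_tape G)
  have 2: "wf_com k G (print_lit l)" for l
    by (cases l) (auto simp: 1 wf_com_put G simp del: put.simps)
  have "wf_com k G (foldr (\<lambda>l c. print_lit l ;; c) ls (put out [False]))" for ls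
    by (induction ls) (auto simp: 2 wf_com_put G simp del: put.simps)
  then have 3: "wf_com k G (print_clause ls)" for ls
    by (auto simp: print_clause_def wf_com_put G simp del: put.simps)
  show ?thesis
    unfolding print_clauses_def by (induction cls) (auto simp: 3)
qed

definition regs :: "nat set \<Rightarrow> nat \<Rightarrow> (nat \<Rightarrow> nat) \<Rightarrow> (nat \<Rightarrow> symbol list \<times> int) \<Rightarrow> bool" where
  "regs J Z len \<sigma> \<longleftrightarrow> (\<forall>j\<in>J. j < k \<and> j \<noteq> out \<and> \<sigma> j = un (len j) \<and> len j \<le> Z)"

lemma gen_print_tapes:
  assumes "regs (set js) Z len \<sigma>"
  shows "gen (print_tapes js) \<sigma> (length js * (9 * Z + 8)) (replicate (sum_list (map len js)) True) \<sigma>"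
  using assms
proof (induction js)
  case Nil
  show ?case by (simp add: gen_Skip)
next
  case (Cons j js)
  have "gen (add_tape j out) \<sigma> (9 * len j + 7) (replicate (len j) True) \<sigma>"
    using Cons.prems by (intro gen_print_tape) (auto simp: regs_def)
  from gen_Seq[OF this Cons.IH]
  have "gen (print_tapes (j # js)) \<sigma> (9 * len j + 7 + length js * (9 * Z + 8) + 1)
     (replicate (sum_list (map len (j # js))) True) \<sigma>"
    using Cons.prems by (simp add: replicate_add regs_def)
  then show ?case by (rule gen_mono) (use Cons.prems in \<open>auto simp: regs_def\<close>)
qed

lemma gen_print_lit:
  assumes "regs (set js) Z len \<sigma>"
  shows "gen (print_lit (s, js, a)) \<sigma> (lit_cost (s, js, a) * (Z + 1))
     (True # enc_edge (lit_edge (inst_lit len (s, js, a)))) \<sigma>"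
proof -
  have "replicate n True @ enc_nat a = enc_nat (n + a)" for n
    by (simp add: enc_nat_def replicate_add)
  then have "gen (print_lit (s, js, a)) \<sigma> (2 * length (True # enc_nat (if s then 0 else 1)) +
      (length js * (9 * Z + 8) + 2 * length (enc_nat a) + 1) + 1)
      (True # enc_edge (lit_edge (inst_lit len (s, js, a)))) \<sigma>"
    using gen_Seq[OF gen_print[of "True # enc_nat (if s then 0 else 1)"]
        gen_Seq[OF gen_print_tapes[OF assms] gen_print[of "enc_nat a"]]]
    by (simp add: lit_edge_def del: put.simps)
  then show ?thesis by (rule gen_mono) (simp add: enc_nat_def algebra_simps)
qed

lemma gen_print_clause:
  assumes "regs (template_tapes [ls]) Z len \<sigma>"
  shows "gen (print_clause ls) \<sigma> (clause_cost ls * (Z + 1))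
     (True # enc_sample (clause_sample (map (inst_lit len) ls))) \<sigma>"
proof -
  have "gen (foldr (\<lambda>l c. print_lit l ;; c) ls (put out [False])) \<sigma>
     (sum_list (map (\<lambda>l. lit_cost l + 1) ls) * (Z + 1) + 2)
     (enc_list enc_edge (map lit_edge (map (inst_lit len) ls))) \<sigma>"
    using assms
  proof (induction ls)
    case Nil
    show ?case by (rule gen_weaken) (auto intro: gen_print[of "[False]", simplified] simp: enc_list_def)
  next
    case (Cons l ls)
    obtain s js a where l: "l = (s, js, a)" by (cases l)
    have "gen (print_lit l) \<sigma> (lit_cost l * (Z + 1)) (True # enc_edge (lit_edge (inst_lit len l))) \<sigma>"
      unfolding l using Cons.prems by (intro gen_print_lit) (auto simp: l regs_def template_tapes_def)
    from gen_Seq[OF this Cons.IH]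
    show ?case
      unfolding foldr.simps o_apply
      by (rule gen_weaken)
        (use Cons.prems in \<open>auto simp: regs_def template_tapes_def enc_list_def algebra_simps\<close>)
  qed
  from gen_Seq[OF gen_print[of "[True, False]"] this]
  show ?thesis
    unfolding print_clause_def
    by (rule gen_weaken) (auto simp: clause_sample_def clause_cost_def algebra_simps)
qed

lemma gen_print_clauses:
  assumes "regs J Z len \<sigma>" "template_tapes cls \<subseteq> J"
  shows "gen (print_clauses cls) \<sigma> (clauses_cost cls * (Z + 1)) (enc_clauses (inst_clauses len cls)) \<sigma>"
  using assms(2)
proof (induction cls)
  case Nil
  show ?case by (simp add: print_clauses_def enc_clauses_def inst_clauses_def gen_Skip)
next
  case (Cons ls cls)
  have "regs (template_tapes [ls]) Z len \<sigma>"
    using assms(1) Cons.prems by (auto simp: regs_def template_tapes_def)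
  from gen_Seq[OF gen_print_clause[OF this] Cons.IH]
  show ?case
    unfolding print_clauses_def foldr.simps o_apply
    by (rule gen_weaken) (use Cons.prems in \<open>auto simp: enc_clauses_def inst_clauses_def
      clauses_cost_def template_tapes_def algebra_simps\<close>)
qed

end

section \<open>Satisfiability as a consistency problem\<close>

definition sat :: "(nat \<Rightarrow> bool) \<Rightarrow> (bool \<times> nat) list list \<Rightarrow> bool" where
  "sat \<alpha> cls \<longleftrightarrow> (\<forall>cl \<in> set cls. \<exists>(s, v) \<in> set cl. \<alpha> v = s)"

definition cnf_samples :: "(bool \<times> nat) list list \<Rightarrow> ((nat \<times> nat) list \<times> bool) list" where
  "cnf_samples cls = ([(0, 1)], True) # map clause_sample cls"

lemma proper_2_coloring_edge_set:
  assumes "\<forall>(u, v) \<in> set es. u < n \<and> v < n"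
  shows "proper_2_coloring {..<n} (edge_set es) X \<longleftrightarrow> (\<forall>(u, v) \<in> set es. (u \<in> X) \<noteq> (v \<in> X))"
proof
  assume L: "proper_2_coloring {..<n} (edge_set es) X"
  show "\<forall>(u, v) \<in> set es. (u \<in> X) \<noteq> (v \<in> X)"
  proof clarify
    fix u v assume uv: "(u, v) \<in> set es" "(u \<in> X) = (v \<in> X)"
    have "{u, v} \<in> edge_set es" using uv(1) by (force simp: edge_set_def)
    moreover have "u < n" "v < n" using assms uv(1) by auto
    ultimately show False
      using L uv(2) by (auto simp: proper_2_coloring_def independent_def)
  qed
next
  assume "\<forall>(u, v) \<in> set es. (u \<in> X) \<noteq> (v \<in> X)"
  then show "proper_2_coloring {..<n} (edge_set es) X"
    by (fastforce simp: proper_2_coloring_def independent_def edge_set_def doubleton_eq_iff)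
qed

text \<open>Variables starting at 2 keep literal edges from being loops at vertex 0 or 1.\<close>

lemma cnf_samples_instance:
  assumes "2 \<le> n" "\<forall>cl \<in> set cls. \<forall>(s, v) \<in> set cl. 2 \<le> v \<and> v < n"
  shows "(n, cnf_samples cls) \<in> instances"
  using assms
  by (fastforce simp: instances_def cnf_samples_def samples_def clause_sample_def graph_def edge_set_def
      lit_edge_def card_2_iff)

text \<open>The positive sample separates vertices 0 and 1 but does not say which of them lies in
  \<open>X\<close>. A variable is therefore read as true iff its vertex has the color of vertex 0;
  conversely 0 is put into \<open>X\<close> and 1 is left out.\<close>

lemma consistent_cnf_iff_sat:
  assumes n: "2 \<le> n" and vars: "\<forall>cl \<in> set cls. \<forall>(s, v) \<in> set cl. 2 \<le> v \<and> v < n"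
  shows "(\<exists>X. consistent {..<n} (samples (cnf_samples cls)) X) \<longleftrightarrow> (\<exists>\<alpha>. sat \<alpha> cls)"
proof -
  have edges: "\<forall>(u, v) \<in> set (map lit_edge cl). u < n \<and> v < n" if "cl \<in> set cls" for cl
    using that vars n by (fastforce simp: lit_edge_def)
  have con: "consistent {..<n} (samples (cnf_samples cls)) X \<longleftrightarrow>
      X \<subseteq> {..<n} \<and> (0 \<in> X) \<noteq> (1 \<in> X) \<and>
      (\<forall>cl \<in> set cls. \<exists>(s, v) \<in> set cl. ((if s then 0 else 1) \<in> X) = (v \<in> X))" for X
  proof -
    have "proper_2_coloring {..<n} (edge_set [(0, 1)]) X \<longleftrightarrow> (0 \<in> X) \<noteq> (1 \<in> X)"
      using n by (subst proper_2_coloring_edge_set) auto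
    moreover have "\<not> proper_2_coloring {..<n} (edge_set (map lit_edge cl)) X \<longleftrightarrow>
        (\<exists>(s, v) \<in> set cl. ((if s then 0 else 1) \<in> X) = (v \<in> X))" if "cl \<in> set cls" for cl
      unfolding proper_2_coloring_edge_set[OF edges[OF that]] by (simp add: lit_edge_def split_beta)
    ultimately show ?thesis
      by (auto simp: consistent_def samples_def cnf_samples_def clause_sample_def simp del: map_map)
  qed
  show ?thesis
  proof
    assume "\<exists>X. consistent {..<n} (samples (cnf_samples cls)) X"
    then obtain X where "consistent {..<n} (samples (cnf_samples cls)) X" ..
    then have X: "(0 \<in> X) \<noteq> (1 \<in> X)"
      "\<forall>cl \<in> set cls. \<exists>(s, v) \<in> set cl. ((if s then 0 else 1) \<in> X) = (v \<in> X)"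
      unfolding con by blast+
    have "sat (\<lambda>v. (v \<in> X) = (0 \<in> X)) cls"
      unfolding sat_def
    proof
      fix cl assume "cl \<in> set cls"
      then obtain s v where sv: "(s, v) \<in> set cl" "((if s then 0 else 1) \<in> X) = (v \<in> X)"
        using X(2) by blast
      then have "((v \<in> X) = (0 \<in> X)) = s" using X(1) by (cases s) auto
      with sv(1) show "\<exists>(s, v) \<in> set cl. ((v \<in> X) = (0 \<in> X)) = s" by blast
    qed
    then show "\<exists>\<alpha>. sat \<alpha> cls" by blast
  next
    assume "\<exists>\<alpha>. sat \<alpha> cls"
    then obtain \<alpha> where \<alpha>: "sat \<alpha> cls" by blast
    define X where "X = {v. v < n \<and> (v = 0 \<or> 2 \<le> v \<and> \<alpha> v)}"
    have "\<exists>(s, v) \<in> set cl. ((if s then 0 else 1) \<in> X) = (v \<in> X)" if cl: "cl \<in> set cls" for cl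
    proof -
      obtain s v where sv: "(s, v) \<in> set cl" "\<alpha> v = s" using \<alpha> cl by (auto simp: sat_def)
      then have "2 \<le> v" "v < n" using vars cl by auto
      then have "((if s then 0 else 1) \<in> X) = (v \<in> X)" using sv(2) n by (auto simp: X_def)
      with sv(1) show ?thesis by blast
    qed
    moreover have "X \<subseteq> {..<n}" "(0 \<in> X) \<noteq> (1 \<in> X)" using n by (auto simp: X_def)
    ultimately have "consistent {..<n} (samples (cnf_samples cls)) X"
      unfolding con by (intro conjI ballI)
    then show "\<exists>X. consistent {..<n} (samples (cnf_samples cls)) X" by blast
  qed
qed

section \<open>Alphabets of reachable tapes and runs of prescribed length\<close>

definition tape_symbols :: "tm \<Rightarrow> symbol set" where
  "tape_symbols M = {Blank} \<union> range Bit \<union> (\<Union>(q, rs, q', as) \<in> transitions M. fst ` set as)"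

lemma finite_tape_symbols: "wf_tm M \<Longrightarrow> finite (tape_symbols M)"
  unfolding tape_symbols_def wf_tm_def by (auto simp: UNIV_bool)

lemma step_tapes_over:
  assumes "wf_tm M" "step M c d" "tapes_over (tapes M) G (snd c)" "tape_symbols M \<subseteq> G"
  shows "tapes_over (tapes M) G (snd d)"
  using assms(2)
proof cases
  case (1 q ts q' as)
  have "length as = tapes M" using assms(1) 1(3) by (auto simp: wf_tm_def)
  moreover have "fst ` set as \<subseteq> tape_symbols M"
    using UN_upper[OF 1(3), of "\<lambda>(q, rs, q', as). fst ` set as"] by (auto simp: tape_symbols_def)
  ultimately show ?thesis
    using tapes_over_act[of "tapes M" G ts as] assms(3,4) by (simp add: 1)
qed

lemma tapes_over_init_config:
  assumes "wf_tm M" "tape_symbols M \<subseteq> G"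
  shows "tapes_over (tapes M) G (snd (init M x))"
  using assms tapes_over_init[of G "tapes M" x] by (simp add: init_def wf_tm_def tape_symbols_def)

lemma reachable_tapes_over:
  assumes "wf_tm M" "tape_symbols M \<subseteq> G" "(step M ^^ n) (init M x) d"
  shows "tapes_over (tapes M) G (snd d)"
  using assms(3)
proof (induction n arbitrary: d)
  case 0
  then show ?case using tapes_over_init_config[OF assms(1,2), of x] by simp
next
  case (Suc n)
  then obtain c where "(step M ^^ n) (init M x) c" "step M c d" by auto
  then show ?case using Suc.IH step_tapes_over[OF assms(1)] assms(2) by blast
qed

text \<open>Letting accepting halted configurations loop turns acceptance in time less than \<open>T\<close> into the
  existence of a run of length exactly \<open>T\<close>.\<close>

definition idle :: "tm \<Rightarrow> trans set" where
  "idle N = {(q, rs, q, nop rs) | q rs. q \<in> accepting N \<and> length rs = tapes N \<and>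
     set rs \<subseteq> tape_symbols N \<and> (\<nexists>q' as. (q, rs, q', as) \<in> transitions N)}"

definition add_idle :: "tm \<Rightarrow> tm" where
  "add_idle N = N\<lparr>transitions := transitions N \<union> idle N\<rparr>"

lemma wf_add_idle:
  assumes "wf_tm N"
  shows "wf_tm (add_idle N)"
proof -
  have "idle N \<subseteq> (\<lambda>(q, rs). (q, rs, q, nop rs)) `
      (accepting N \<times> {rs. set rs \<subseteq> tape_symbols N \<and> length rs = tapes N})"
    by (auto simp: idle_def)
  then have "finite (idle N)"
    by (rule finite_subset) (use assms finite_lists_length_eq[OF finite_tape_symbols[OF assms]] in
      \<open>auto simp: wf_tm_def intro!: finite_imageI\<close>)
  then show ?thesis using assms by (auto simp: wf_tm_def add_idle_def idle_def nop_def)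
qed

lemma init_add_idle: "init (add_idle N) x = init N x"
  by (simp add: init_def add_idle_def)

lemma accepts_iff_long_run:
  assumes wf: "wf_tm N" and bound: "\<And>m c. (step N ^^ m) (init N x) c \<Longrightarrow> m < T"
  shows "accepts N x \<longleftrightarrow> (\<exists>d. (step (add_idle N) ^^ T) (init (add_idle N) x) d)"
proof
  assume "accepts N x"
  then obtain h q ts where h: "(step N ^^ h) (init N x) (q, ts)" "halted N (q, ts)" "q \<in> accepting N"
    unfolding accepts_def halts_with_def by (metis prod.collapse rtranclp_imp_relpowp)
  have "tapes_over (tapes N) (tape_symbols N) ts"
    using reachable_tapes_over[OF wf order_refl h(1)] by simp
  then have "length (map read_tape ts) = tapes N" "set (map read_tape ts) \<subseteq> tape_symbols N"
    using tapes_over_reads by blast+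
  moreover have "\<nexists>q' as. (q, map read_tape ts, q', as) \<in> transitions N"
    using h(2) unfolding halted_def by (blast intro: step.intros)
  ultimately have "(q, map read_tape ts, q, nop (map read_tape ts)) \<in> transitions (add_idle N)"
    using h(3) unfolding add_idle_def idle_def by auto
  then have loop: "step (add_idle N) (q, ts) (q, ts)"
    using step.intros[of q ts q "nop (map read_tape ts)" "add_idle N"] by (simp add: map2_act_nop)
  have "step N \<le> step (add_idle N)"
    by (auto elim!: step.cases intro!: step.intros simp: add_idle_def)
  then have "(step (add_idle N) ^^ h) (init N x) (q, ts)" using h(1) relpowp_mono by (metis predicate2D)
  moreover have "(step (add_idle N) ^^ n) (q, ts) (q, ts)" for n
    by (induction n) (use loop in auto)
  ultimately have "(step (add_idle N) ^^ (h + (T - h))) (init N x) (q, ts)"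
    unfolding relpowp_add by blast
  moreover have "h + (T - h) = T" using bound[OF h(1)] by simp
  ultimately show "\<exists>d. (step (add_idle N) ^^ T) (init (add_idle N) x) d" by (auto simp: init_add_idle)
next
  assume "\<exists>d. (step (add_idle N) ^^ T) (init (add_idle N) x) d"
  then obtain d where d: "(step (add_idle N) ^^ T) (init N x) d" by (auto simp: init_add_idle)
  \<comment> \<open>Idle steps exist only in accepting halted configurations, so the first one used
    proves acceptance. A run without idle steps is a run of \<open>N\<close> and cannot have length
    \<open>T\<close>.\<close>
  have "(step N ^^ n) (init N x) c \<or> accepts N x" if "(step (add_idle N) ^^ n) (init N x) c" for n c
    using that
  proof (induction n arbitrary: c)
    case (Suc n)
    then obtain b where b: "(step (add_idle N) ^^ n) (init N x) b" "step (add_idle N) b c" by auto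
    show ?case
    proof (cases "accepts N x")
      case False
      then have nb: "(step N ^^ n) (init N x) b" using Suc.IH[OF b(1)] by blast
      from b(2) show ?thesis
      proof cases
        case (1 q ts q' as)
        show ?thesis
        proof (cases "(q, map read_tape ts, q', as) \<in> transitions N")
          case True
          then have "step N b c" using 1 by (auto intro: step.intros)
          then show ?thesis using nb by auto
        next
          case False
          then have "(q, map read_tape ts, q', as) \<in> idle N" using 1 by (simp add: add_idle_def)
          then have "q \<in> accepting N" "halted N b"
            using 1 by (auto simp: idle_def halted_def elim!: step.cases)
          then show ?thesis
            using relpowp_imp_rtranclp[OF nb] 1 by (auto simp: accepts_def halts_with_def)
        qed
      qed
    qed auto
  qed auto
  from this[OF d] show "accepts N x" using bound by blast
qed

section \<open>The computation tableau\<close>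

abbreviation (input) "inputT \<equiv> 0 :: nat"
abbreviation (input) "cellT \<equiv> 1 :: nat"
abbreviation (input) "rowT \<equiv> 2 :: nat"
abbreviation (input) "initT \<equiv> 3 :: nat"
abbreviation (input) "widthT \<equiv> 4 :: nat"

text \<open>A head move to the left raises the offset of every square by one, a move to the right
  lowers it. The value is this change plus one, which keeps it a natural number.\<close>

fun shift :: "dir \<Rightarrow> nat" where
  "shift Lft = 2" | "shift Stay = 1" | "shift Rgt = 0"

definition input_symbol :: "bool list \<Rightarrow> nat \<Rightarrow> symbol" where
  "input_symbol x i = (if i < length x then Bit (x ! i) else Blank)"

definition cell :: "tape \<Rightarrow> int \<Rightarrow> symbol" where
  "cell t i = fst t (snd t + i)"

lemma cell_0: "cell t 0 = read_tape t"
  by (cases t) (simp add: cell_def)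

text \<open>Offset \<open>i\<close> from the new head position was offset
  \<open>i + 1 - shift d\<close> before the move, and old offset 0 carries the symbol just
  written.\<close>

lemma cell_act: "cell (act (s, d) t) i =
    (if i + 1 = int (shift d) then s else cell t (i + 1 - int (shift d)))"
  by (cases t; cases d) (auto simp: cell_def algebra_simps)

lemma sat_append: "sat \<alpha> (xs @ ys) \<longleftrightarrow> sat \<alpha> xs \<and> sat \<alpha> ys"
  by (auto simp: sat_def)

lemma sat_concat_map: "sat \<alpha> (concat (map f [0..<n])) \<longleftrightarrow> (\<forall>i<n. sat \<alpha> (f i))"
  by (fastforce simp: sat_def)

lemma sat_inst:
  "sat \<alpha> (inst_clauses len cls) \<longleftrightarrow>
     (\<forall>cl \<in> set cls. \<exists>l \<in> set cl. \<alpha> (snd (inst_lit len l)) = fst l)"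
proof -
  have "fst (inst_lit len l) = fst l" for l by (cases l) simp
  then show ?thesis by (simp add: sat_def inst_clauses_def split_beta)
qed

text \<open>Row \<open>t\<close> of the tableau describes the configuration after \<open>t\<close> steps. It has \<open>2 * T + 3\<close> cells; cell
  \<open>T + 1 + i\<close> describes the squares at offset \<open>i\<close> from the heads, so that a head move shifts the row.
  The two outermost cells only receive shifted squares. Slot \<open>\<tau> < length trs\<close> of cell 0 states that
  transition \<open>\<tau>\<close> is taken next. The variable of slot \<open>f\<close> of cell \<open>i\<close> is \<open>var T t i f\<close>; variables start
  at 2 as vertices 0 and 1 represent the truth values.\<close>

locale tableau =
  fixes N :: tm and trs :: "trans list" and gs :: "symbol list"
  assumes wf: "wf_tm N" and trs: "set trs = transitions N" and gs: "set gs = tape_symbols N"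
begin

definition slots :: nat where
  "slots = length trs + tapes N * length gs"

definition slot :: "nat \<Rightarrow> nat \<Rightarrow> nat" where
  "slot j s = length trs + (j * length gs + s)"

definition src :: "nat \<Rightarrow> nat" where "src \<tau> = fst (trs ! \<tau>)"
definition reads :: "nat \<Rightarrow> symbol list" where "reads \<tau> = fst (snd (trs ! \<tau>))"
definition dst :: "nat \<Rightarrow> nat" where "dst \<tau> = fst (snd (snd (trs ! \<tau>)))"
definition acts :: "nat \<Rightarrow> (symbol \<times> dir) list" where "acts \<tau> = snd (snd (snd (trs ! \<tau>)))"

definition var :: "nat \<Rightarrow> nat \<Rightarrow> nat \<Rightarrow> nat \<Rightarrow> nat" where
  "var T t i f = 2 + slots * (t * (2 * T + 3) + i) + f"

text \<open>\<open>widthT\<close> holds one cell less than a row, so that a shift by -1, 0 or 1 is a nonnegative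
  constant.\<close>

definition lens :: "nat \<Rightarrow> nat \<Rightarrow> nat \<Rightarrow> nat \<Rightarrow> nat" where
  "lens T t i = (\<lambda>_. 0)(cellT := slots * (t * (2 * T + 3) + i), rowT := slots * (t * (2 * T + 3)),
     initT := slots * i, widthT := slots * (2 * T + 2))"

definition row_lit :: "bool \<Rightarrow> nat \<Rightarrow> template" where
  "row_lit b f = (b, [rowT], 2 + f)"

text \<open>The extra \<open>slots\<close> is the one cell by which \<open>widthT\<close> falls
  short of a row.\<close>

definition next_row_lit :: "bool \<Rightarrow> nat \<Rightarrow> template" where
  "next_row_lit b f = (b, [rowT, widthT], slots + (2 + f))"

definition cell_lit :: "bool \<Rightarrow> nat \<Rightarrow> template" where
  "cell_lit b f = (b, [cellT], 2 + f)"

text \<open>The cell missing from \<open>widthT\<close> cancels the one that \<open>shift\<close>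
  adds to the change of offset.\<close>

definition next_cell_lit :: "dir \<Rightarrow> nat \<Rightarrow> template" where
  "next_cell_lit d f = (True, [cellT, widthT], slots * shift d + (2 + f))"

definition start_lit :: "nat \<Rightarrow> template" where
  "start_lit f = (False, [], 2 + f)"

definition init_lit :: "nat \<Rightarrow> template" where
  "init_lit f = (True, [initT], 2 + f)"

lemmas lit_defs = row_lit_def next_row_lit_def cell_lit_def next_cell_lit_def start_lit_def init_lit_def

lemma fst_lits [simp]:
  "fst (row_lit b f) = b" "fst (next_row_lit b f) = b" "fst (cell_lit b f) = b"
  "fst (next_cell_lit d f)" "\<not> fst (start_lit f)" "fst (init_lit f)"
  by (simp_all add: lit_defs)

lemma var_lits [simp]:
  "snd (inst_lit (lens T t i) (row_lit b f)) = var T t 0 f"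
  "snd (inst_lit (lens T t i) (next_row_lit b f)) = var T (Suc t) 0 f"
  "snd (inst_lit (lens T t i) (cell_lit b f)) = var T t i f"
  "1 \<le> i \<Longrightarrow> snd (inst_lit (lens T t i) (next_cell_lit d f)) = var T (Suc t) (i + shift d - 1) f"
  "snd (inst_lit (lens T t i) (start_lit f)) = var T 0 0 f"
  "snd (inst_lit (lens T t i) (init_lit f)) = var T 0 i f"
  by (simp_all add: lit_defs lens_def var_def algebra_simps)

definition start_templates :: "template list list" where
  "start_templates = [[start_lit \<tau>]. \<tau> \<leftarrow> [0..<length trs], src \<tau> \<noteq> start N]"

definition init_templates :: "symbol \<Rightarrow> template list list" where
  "init_templates b = [[init_lit (slot j s)]. j \<leftarrow> [0..<tapes N], s \<leftarrow> [0..<length gs],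
     gs ! s = (if j = 0 then b else Blank)]"

text \<open>Each row makes at least one choice, and choices in consecutive rows must fit together.
  If several choices hold in a row, each of them is subject to all clauses, so any one of them can
  be followed.\<close>

definition row_templates :: "template list list" where
  "row_templates = map (row_lit True) [0..<length trs] #
     [[row_lit False \<tau>, next_row_lit False \<tau>'].
        \<tau> \<leftarrow> [0..<length trs], \<tau>' \<leftarrow> [0..<length trs], dst \<tau> \<noteq> src \<tau>']"

definition cell_templates :: "template list list" where
  "cell_templates = [[row_lit False \<tau>, cell_lit False (slot j s),
      next_cell_lit (snd (acts \<tau> ! j)) (slot j s)].
     \<tau> \<leftarrow> [0..<length trs], j \<leftarrow> [0..<tapes N], s \<leftarrow> [0..<length gs]]"

text \<open>The first family is the only place where records are tested: under a chosen transition,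
  the head cell may record nothing but the symbol read. The second family passes on the written
  symbol in place of the old one.\<close>

definition head_templates :: "template list list" where
  "head_templates =
     [[row_lit False \<tau>, cell_lit False (slot j s)].
       \<tau> \<leftarrow> [0..<length trs], j \<leftarrow> [0..<tapes N], s \<leftarrow> [0..<length gs], gs ! s \<noteq> reads \<tau> ! j] @
     [[row_lit False \<tau>,
       next_cell_lit (snd (acts \<tau> ! j)) (slot j s)].
       \<tau> \<leftarrow> [0..<length trs], j \<leftarrow> [0..<tapes N], s \<leftarrow> [0..<length gs], gs ! s = fst (acts \<tau> ! j)]"

definition init_clauses :: "nat \<Rightarrow> bool list \<Rightarrow> (bool \<times> nat) list list" where
  "init_clauses T x = inst_clauses (lens T 0 0) start_templates @
     concat (map (\<lambda>i. inst_clauses (lens T 0 (1 + i)) (init_templates Blank)) [0..<T]) @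
     inst_clauses (lens T 0 (T + 1)) (init_templates (input_symbol x 0)) @
     concat (map (\<lambda>i. inst_clauses (lens T 0 (T + 2 + i)) (init_templates (input_symbol x (Suc i))))
       [0..<T])"

definition row_clauses :: "nat \<Rightarrow> nat \<Rightarrow> (bool \<times> nat) list list" where
  "row_clauses T t = inst_clauses (lens T t 0) row_templates @
     concat (map (\<lambda>i. inst_clauses (lens T t (1 + i)) cell_templates) [0..<T]) @
     inst_clauses (lens T t (T + 1)) head_templates @
     concat (map (\<lambda>i. inst_clauses (lens T t (T + 2 + i)) cell_templates) [0..<T])"

definition tableau_clauses :: "nat \<Rightarrow> bool list \<Rightarrow> (bool \<times> nat) list list" where
  "tableau_clauses T x = init_clauses T x @ concat (map (row_clauses T) [0..<T])"

lemma sat_start: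
  "sat \<alpha> (inst_clauses (lens T 0 0) start_templates) \<longleftrightarrow>
     (\<forall>\<tau><length trs. src \<tau> \<noteq> start N \<longrightarrow> \<not> \<alpha> (var T 0 0 \<tau>))"
  by (auto simp: sat_inst start_templates_def)

lemma sat_init:
  "sat \<alpha> (inst_clauses (lens T 0 i) (init_templates b)) \<longleftrightarrow>
     (\<forall>j<tapes N. \<forall>s<length gs. gs ! s = (if j = 0 then b else Blank) \<longrightarrow> \<alpha> (var T 0 i (slot j s)))"
  by (auto simp: sat_inst init_templates_def)

lemma sat_row:
  "sat \<alpha> (inst_clauses (lens T t 0) row_templates) \<longleftrightarrow>
     (\<exists>\<tau><length trs. \<alpha> (var T t 0 \<tau>)) \<and>
     (\<forall>\<tau><length trs. \<forall>\<tau>'<length trs. dst \<tau> \<noteq> src \<tau>' \<longrightarrow>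
        \<not> \<alpha> (var T t 0 \<tau>) \<or> \<not> \<alpha> (var T (Suc t) 0 \<tau>'))"
  by (auto simp: sat_inst row_templates_def ball_Un)

lemma sat_cell:
  assumes "1 \<le> i"
  shows "sat \<alpha> (inst_clauses (lens T t i) cell_templates) \<longleftrightarrow>
     (\<forall>\<tau><length trs. \<forall>j<tapes N. \<forall>s<length gs. \<alpha> (var T t 0 \<tau>) \<longrightarrow> \<alpha> (var T t i (slot j s)) \<longrightarrow>
        \<alpha> (var T (Suc t) (i + shift (snd (acts \<tau> ! j)) - 1) (slot j s)))"
  using assms by (auto simp: sat_inst cell_templates_def ball_Un)

lemma sat_head:
  assumes "1 \<le> i"
  shows "sat \<alpha> (inst_clauses (lens T t i) head_templates) \<longleftrightarrow>
     (\<forall>\<tau><length trs. \<forall>j<tapes N. \<forall>s<length gs. gs ! s \<noteq> reads \<tau> ! j \<longrightarrow>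
        \<alpha> (var T t 0 \<tau>) \<longrightarrow> \<not> \<alpha> (var T t i (slot j s))) \<and>
     (\<forall>\<tau><length trs. \<forall>j<tapes N. \<forall>s<length gs. gs ! s = fst (acts \<tau> ! j) \<longrightarrow>
        \<alpha> (var T t 0 \<tau>) \<longrightarrow>
        \<alpha> (var T (Suc t) (i + shift (snd (acts \<tau> ! j)) - 1) (slot j s)))"
  using assms by (auto simp: sat_inst head_templates_def ball_Un)

section \<open>Satisfying assignments and runs\<close>

lemma transition_components:
  assumes "\<tau> < length trs"
  shows "(src \<tau>, reads \<tau>, dst \<tau>, acts \<tau>) \<in> transitions N"
    "length (reads \<tau>) = tapes N" "length (acts \<tau>) = tapes N" "fst ` set (acts \<tau>) \<subseteq> set gs"
proof -
  have *: "(src \<tau>, reads \<tau>, dst \<tau>, acts \<tau>) \<in> transitions N"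
    using assms trs nth_mem by (fastforce simp: src_def reads_def dst_def acts_def)
  then show "(src \<tau>, reads \<tau>, dst \<tau>, acts \<tau>) \<in> transitions N" .
  show "length (reads \<tau>) = tapes N" "length (acts \<tau>) = tapes N"
    using * wf by (auto simp: wf_tm_def)
  show "fst ` set (acts \<tau>) \<subseteq> set gs"
    using UN_upper[OF *, of "\<lambda>(q, rs, q', as). fst ` set as"] by (auto simp: gs tape_symbols_def)
qed

lemma sat_tableau:
  "sat \<alpha> (tableau_clauses T x) \<longleftrightarrow>
     sat \<alpha> (inst_clauses (lens T 0 0) start_templates) \<and>
     (\<forall>i<T. sat \<alpha> (inst_clauses (lens T 0 (1 + i)) (init_templates Blank))) \<and>
     sat \<alpha> (inst_clauses (lens T 0 (T + 1)) (init_templates (input_symbol x 0))) \<and>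
     (\<forall>i<T. sat \<alpha> (inst_clauses (lens T 0 (T + 2 + i)) (init_templates (input_symbol x (Suc i))))) \<and>
     (\<forall>t<T. sat \<alpha> (inst_clauses (lens T t 0) row_templates) \<and>
       (\<forall>i<T. sat \<alpha> (inst_clauses (lens T t (1 + i)) cell_templates)) \<and>
       sat \<alpha> (inst_clauses (lens T t (T + 1)) head_templates) \<and>
       (\<forall>i<T. sat \<alpha> (inst_clauses (lens T t (T + 2 + i)) cell_templates)))"
  by (simp add: tableau_clauses_def init_clauses_def row_clauses_def sat_append sat_concat_map)

lemma cell_init:
  assumes "j < tapes N"
  shows "cell (snd (init N x) ! j) i =
    (if j = 0 \<and> 0 \<le> i then input_symbol x (nat i) else Blank)"
  using assms
  by (cases j) (auto simp: init_def cell_def input_tape_def blank_tape_def input_symbol_def nat_less_iff)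

text \<open>The transitions chosen by \<alpha> are executed one after the other. The invariant says
  that \<alpha> records the true symbols near the head. A head clause forbids recording a symbol
  other than the one the chosen transition reads, so the true symbol is that one and the transition
  applies.\<close>

lemma run_of_sat:
  assumes sat: "sat \<alpha> (tableau_clauses T x)"
  shows "\<exists>d. (step N ^^ T) (init N x) d"
proof -
  note S = sat[unfolded sat_tableau]
  have sat_s: "sat \<alpha> (inst_clauses (lens T 0 0) start_templates)"
    and sat_l: "\<And>i. i < T \<Longrightarrow> sat \<alpha> (inst_clauses (lens T 0 (1 + i)) (init_templates Blank))"
    and sat_m: "sat \<alpha> (inst_clauses (lens T 0 (T + 1)) (init_templates (input_symbol x 0)))"
    and sat_r: "\<And>i. i < T \<Longrightarrow>
      sat \<alpha> (inst_clauses (lens T 0 (T + 2 + i)) (init_templates (input_symbol x (Suc i))))"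
    and sat_rows: "\<And>t. t < T \<Longrightarrow> sat \<alpha> (inst_clauses (lens T t 0) row_templates)"
    and sat_cl: "\<And>t i. t < T \<Longrightarrow> i < T \<Longrightarrow> sat \<alpha> (inst_clauses (lens T t (1 + i)) cell_templates)"
    and sat_cr: "\<And>t i. t < T \<Longrightarrow> i < T \<Longrightarrow> sat \<alpha> (inst_clauses (lens T t (T + 2 + i)) cell_templates)"
    and head: "\<And>t. t < T \<Longrightarrow> sat \<alpha> (inst_clauses (lens T t (T + 1)) head_templates)"
    using S by simp_all
  have "\<forall>t<T. \<exists>\<tau><length trs. \<alpha> (var T t 0 \<tau>)" using sat_rows unfolding sat_row by blast
  then obtain \<tau> where \<tau>: "\<And>t. t < T \<Longrightarrow> \<tau> t < length trs" "\<And>t. t < T \<Longrightarrow> \<alpha> (var T t 0 (\<tau> t))"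
    by metis
  have start: "src (\<tau> 0) = start N" if "0 < T" using sat_s \<tau>[OF that] unfolding sat_start by blast
  have link: "src (\<tau> (Suc t)) = dst (\<tau> t)" if "Suc t < T" for t
    using sat_rows[OF Suc_lessD[OF that]] \<tau>[OF that] \<tau>[OF Suc_lessD[OF that]] unfolding sat_row by fastforce
  have cell_step: "\<alpha> (var T (Suc t) (i + shift (snd (acts (\<tau> t) ! j)) - 1) (slot j s))"
    if "t < T" "1 \<le> i" "i \<le> 2 * T + 1" "i \<noteq> T + 1" "j < tapes N" "s < length gs"
      "\<alpha> (var T t i (slot j s))" for t i j s
  proof -
    have "sat \<alpha> (inst_clauses (lens T t i) cell_templates)"
    proof (cases "i \<le> T")
      case True
      then have "i = 1 + (i - 1)" "i - 1 < T" using that by auto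
      then show ?thesis using sat_cl[OF that(1)] by metis
    next
      case False
      then have "i = T + 2 + (i - (T + 2))" "i - (T + 2) < T" using that by auto
      then show ?thesis using sat_cr[OF that(1)] by metis
    qed
    then show ?thesis using sat_cell[OF that(2)] \<tau>[OF that(1)] that by blast
  qed
  \<comment> \<open>The chosen transitions are applied blindly; the induction below shows that each
    application is a legal step.\<close>
  define cs where "cs = rec_nat (init N x) (\<lambda>t c. (dst (\<tau> t), map2 act (acts (\<tau> t)) (snd c)))"
  have cs_0: "cs 0 = init N x" and
    cs_Suc: "cs (Suc t) = (dst (\<tau> t), map2 act (acts (\<tau> t)) (snd (cs t)))" for t
    by (simp_all add: cs_def)
  \<comment> \<open>The two inequalities amount to \<open>t + 1 \<le> i\<close> and
    \<open>i \<le> 2 * T + 1 - t\<close>: the trusted window around cell \<open>T + 1\<close> loses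
    one cell on each side per step, because a shift may bring in an unknown cell.\<close>
  have "(step N ^^ t) (init N x) (cs t) \<and> (t < T \<longrightarrow> fst (cs t) = src (\<tau> t)) \<and>
      (\<forall>j<tapes N. \<forall>i s. int T + 1 - int i \<le> int T - int t \<longrightarrow> int i - int T - 1 \<le> int T - int t \<longrightarrow>
         s < length gs \<longrightarrow> gs ! s = cell (snd (cs t) ! j) (int i - int T - 1) \<longrightarrow>
         \<alpha> (var T t i (slot j s)))" if "t \<le> T" for t
    using that
  proof (induction t)
    case 0
    have "\<alpha> (var T 0 i (slot j s))"
      if j: "j < tapes N" and i: "int T + 1 - int i \<le> int T" "int i - int T - 1 \<le> int T"
        and s: "s < length gs" "gs ! s = cell (snd (init N x) ! j) (int i - int T - 1)" for j i s
    proof -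
      consider "1 \<le> i" "i \<le> T" | "i = T + 1" | "T + 2 \<le> i" "i \<le> 2 * T + 1" using i by linarith
      then show ?thesis
      proof cases
        case 1
        then have eq: "i = 1 + (i - 1)" "i - 1 < T" by auto
        have "gs ! s = (if j = 0 then Blank else Blank)"
          using s(2) cell_init[OF j, of x "int i - int T - 1"] 1 by auto
        then show ?thesis using sat_l[OF eq(2)] j s(1) eq(1) unfolding sat_init by metis
      next
        case 2
        then have "gs ! s = (if j = 0 then input_symbol x 0 else Blank)"
          using s(2) cell_init[OF j, of x "int i - int T - 1"] by auto
        then show ?thesis using sat_m j s(1) 2 unfolding sat_init by metis
      next
        case 3
        then have eq: "i = T + 2 + (i - (T + 2))" "i - (T + 2) < T" by auto
        have "nat (int i - int T - 1) = Suc (i - (T + 2))" using 3 by auto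
        then have "gs ! s = (if j = 0 then input_symbol x (Suc (i - (T + 2))) else Blank)"
          using s(2) cell_init[OF j, of x "int i - int T - 1"] 3 by auto
        then have "\<alpha> (var T 0 (T + 2 + (i - (T + 2))) (slot j s))" using sat_r[OF eq(2)] j s(1) unfolding sat_init by blast
        then show ?thesis using eq(1) by metis
      qed
    qed
    then show ?case using start by (auto simp: cs_0 init_def)
  next
    case (Suc t)
    then have t: "t < T" by simp
    note IH = Suc.IH[OF less_imp_le[OF t]]
    have run: "(step N ^^ t) (init N x) (cs t)" and st: "fst (cs t) = src (\<tau> t)" using IH t by auto
    have over: "tapes_over (tapes N) (set gs) (snd (cs t))"
      using reachable_tapes_over[OF wf _ run] gs by simp
    then have len: "length (snd (cs t)) = tapes N" by (simp add: tapes_over_def)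
    have sym: "\<exists>s<length gs. gs ! s = cell (snd (cs t) ! j) i" if "j < tapes N" for j i
    proof -
      have "cell (snd (cs t) ! j) i \<in> set gs"
        using over that by (auto simp: tapes_over_def cell_def image_subset_iff)
      then show ?thesis by (simp add: in_set_conv_nth)
    qed
    note comp = transition_components[OF \<tau>(1)[OF t]]
    have "map read_tape (snd (cs t)) = reads (\<tau> t)"
    proof (rule nth_equalityI)
      fix j assume "j < length (map read_tape (snd (cs t)))"
      then have j: "j < tapes N" using len by simp
      obtain s where s: "s < length gs" "gs ! s = cell (snd (cs t) ! j) 0" using sym[OF j] by blast
      have "\<alpha> (var T t (T + 1) (slot j s))" using IH j s t by simp
      then have "gs ! s = reads (\<tau> t) ! j"
        using head[OF t] sat_head[of "T + 1" \<alpha> T t] \<tau>[OF t] j s(1) by auto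
      then show "map read_tape (snd (cs t)) ! j = reads (\<tau> t) ! j"
        using s(2) j len by (simp add: cell_0)
    qed (use len comp in simp)
    then have "(fst (cs t), map read_tape (snd (cs t)), dst (\<tau> t), acts (\<tau> t)) \<in> transitions N"
      using comp(1) st by simp
    then have "step N (cs t) (cs (Suc t))"
      using step.intros[of "fst (cs t)" "snd (cs t)"] by (simp add: cs_Suc)
    then have 1: "(step N ^^ Suc t) (init N x) (cs (Suc t))" using run by auto
    have 2: "\<alpha> (var T (Suc t) i (slot j s))"
      if j: "j < tapes N" and i: "int T + 1 - int i \<le> int T - int (Suc t)"
        "int i - int T - 1 \<le> int T - int (Suc t)"
        and s: "s < length gs" "gs ! s = cell (snd (cs (Suc t)) ! j) (int i - int T - 1)" for j i s
    proof -
      obtain w d where wd: "acts (\<tau> t) ! j = (w, d)" by fastforce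
      \<comment> \<open>This is the cell of row \<open>t\<close> whose content ends up in cell
        \<open>i\<close>. The case \<open>i' = T + 1\<close> is the square under the old head, which
        has been overwritten.\<close>
      define i' where "i' = i + 1 - shift d"
      have sh: "shift d \<le> 2" by (cases d) auto
      have i': "i' + shift d - 1 = i" "int i' = int i + 1 - int (shift d)" "1 \<le> i'" "i' \<le> 2 * T + 1"
        using i sh t by (auto simp: i'_def)
      have nxt: "snd (cs (Suc t)) ! j = act (w, d) (snd (cs t) ! j)"
        using j len comp(3) by (simp add: cs_Suc wd)
      show ?thesis
      proof (cases "i' = T + 1")
        case True
        then have "int i - int T - 1 + 1 = int (shift d)" using i' by simp
        then have "gs ! s = fst (acts (\<tau> t) ! j)" using s(2) wd unfolding nxt cell_act by simp
        then have "\<alpha> (var T (Suc t) (T + 1 + shift (snd (acts (\<tau> t) ! j)) - 1) (slot j s))"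
          using head[OF t] \<tau>[OF t] j s(1) unfolding sat_head[OF le_add2] by blast
        then show ?thesis using wd i'(1) True by simp
      next
        case False
        then have "int i - int T - 1 + 1 \<noteq> int (shift d)" using i' by linarith
        moreover have "int i - int T - 1 + 1 - int (shift d) = int i' - int T - 1" using i'(2) by simp
        ultimately have "gs ! s = cell (snd (cs t) ! j) (int i' - int T - 1)"
          using s(2) unfolding nxt cell_act by metis
        moreover have "int T + 1 - int i' \<le> int T - int t" "int i' - int T - 1 \<le> int T - int t"
          using i i'(2) sh by linarith+
        ultimately have "\<alpha> (var T t i' (slot j s))" using IH j s(1) by blast
        then show ?thesis using cell_step[OF t i'(3,4) False j s(1)] wd i'(1) by simp
      qed
    qed
    have "fst (cs (Suc t)) = src (\<tau> (Suc t))" if "Suc t < T" using link[OF that] by (simp add: cs_Suc)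
    with 1 2 show ?case by blast
  qed
  from this[of T] show ?thesis by blast
qed

text \<open>The mixed-radix digits of a variable number, which recover the arguments of
  \<open>var\<close>.\<close>

definition decode :: "nat \<Rightarrow> (nat \<Rightarrow> nat \<Rightarrow> nat \<Rightarrow> bool) \<Rightarrow> nat \<Rightarrow> bool" where
  "decode T V v = V ((v - 2) div slots div (2 * T + 3)) ((v - 2) div slots mod (2 * T + 3)) ((v - 2) mod slots)"

lemma decode_var: "i < 2 * T + 3 \<Longrightarrow> f < slots \<Longrightarrow> decode T V (var T t i f) = V t i f"
  by (simp add: decode_def var_def)

lemma slot_less: "j < tapes N \<Longrightarrow> s < length gs \<Longrightarrow> slot j s < slots"
proof -
  assume "j < tapes N" "s < length gs"
  then have "j * length gs + s < Suc j * length gs" "Suc j * length gs \<le> tapes N * length gs"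
    by (simp, intro mult_le_mono1, simp)
  then show ?thesis by (simp add: slot_def slots_def)
qed

lemma choice_less: "\<tau> < length trs \<Longrightarrow> \<tau> < slots"
  by (simp add: slots_def)

text \<open>Every variable receives the truth value of the statement about the run that it stands
  for.\<close>

lemma sat_of_run:
  assumes "(step N ^^ T) (init N x) d"
  shows "\<exists>\<alpha>. sat \<alpha> (tableau_clauses T x)"
proof -
  obtain cs where cs: "cs 0 = init N x" "\<And>t. t < T \<Longrightarrow> step N (cs t) (cs (Suc t))"
    using assms unfolding relpowp_fun_conv by blast
  have "\<exists>\<tau><length trs. src \<tau> = fst (cs t) \<and> reads \<tau> = map read_tape (snd (cs t)) \<and>
      cs (Suc t) = (dst \<tau>, map2 act (acts \<tau>) (snd (cs t)))" if "t < T" for t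
    using cs(2)[OF that]
  proof cases
    case (1 q ts q' as)
    then obtain \<tau> where "\<tau> < length trs" "trs ! \<tau> = (q, map read_tape ts, q', as)"
      using trs by (metis in_set_conv_nth)
    then show ?thesis using 1 by (auto simp: src_def reads_def dst_def acts_def intro!: exI[of _ \<tau>])
  qed
  then obtain \<tau> where \<tau>: "\<And>t. t < T \<Longrightarrow> \<tau> t < length trs" "\<And>t. t < T \<Longrightarrow> src (\<tau> t) = fst (cs t)"
    "\<And>t. t < T \<Longrightarrow> reads (\<tau> t) = map read_tape (snd (cs t))"
    "\<And>t. t < T \<Longrightarrow> cs (Suc t) = (dst (\<tau> t), map2 act (acts (\<tau> t)) (snd (cs t)))"
    by metis
  have len: "length (snd (cs t)) = tapes N" if "t \<le> T" for t
    using that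
  proof (induction t)
    case 0
    then show ?case using wf by (simp add: cs init_def wf_tm_def)
  next
    case (Suc t)
    then show ?case using \<tau>(4)[of t] transition_components(3)[OF \<tau>(1)[of t]] by simp
  qed
  \<comment> \<open>Row \<open>T\<close> describes the last configuration, from which no transition
    is taken; hence the conjunct \<open>t < T\<close>.\<close>
  define V where "V t i f = (if f < length trs then t < T \<and> f = \<tau> t
    else cell (snd (cs t) ! ((f - length trs) div length gs)) (int i - int T - 1)
      = gs ! ((f - length trs) mod length gs))" for t i f
  let ?\<alpha> = "decode T V"
  have choice: "?\<alpha> (var T t 0 f) \<longleftrightarrow> t < T \<and> f = \<tau> t" if "f < length trs" for t f
    using that choice_less[OF that] by (simp add: decode_var V_def)
  have content: "?\<alpha> (var T t i (slot j s)) \<longleftrightarrow> cell (snd (cs t) ! j) (int i - int T - 1) = gs ! s"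
    if "i < 2 * T + 3" "j < tapes N" "s < length gs" for t i j s
  proof -
    have "(j * length gs + s) div length gs = j" "(j * length gs + s) mod length gs = s"
      using that(3) by (auto simp: div_add1_eq)
    then show ?thesis using that slot_less[OF that(2,3)] by (simp add: decode_var V_def slot_def)
  qed
  have shift: "shift d \<le> 2" for d by (cases d) auto
  have nxt: "snd (cs (Suc t)) ! j = act (acts (\<tau> t) ! j) (snd (cs t) ! j)" if "t < T" "j < tapes N" for t j
    using that \<tau>(4) len[of t] transition_components(3)[OF \<tau>(1)[of t]] by simp
  have cell_ok: "sat ?\<alpha> (inst_clauses (lens T t i) cell_templates)"
    if i: "1 \<le> i" "i \<le> 2 * T + 1" "i \<noteq> T + 1" and t: "t < T" for t i
    unfolding sat_cell[OF i(1)]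
  proof (intro allI impI)
    fix f j s assume f: "f < length trs" and j: "j < tapes N" and s: "s < length gs"
      and "?\<alpha> (var T t 0 f)" and old: "?\<alpha> (var T t i (slot j s))"
    then have [simp]: "f = \<tau> t" using choice[OF f] by blast
    obtain w e where we: "acts (\<tau> t) ! j = (w, e)" by fastforce
    have e: "i + shift e - 1 < 2 * T + 3" using i shift[of e] by linarith
    have "cell (snd (cs t) ! j) (int i - int T - 1) = gs ! s" using content[of i j s t] old i j s by simp
    moreover have "int (i + shift e - 1) = int i + int (shift e) - 1" using i by simp
    ultimately have "cell (snd (cs (Suc t)) ! j) (int (i + shift e - 1) - int T - 1) = gs ! s"
      unfolding nxt[OF t j] we cell_act using i(3) by (simp add: algebra_simps)
    then show "?\<alpha> (var T (Suc t) (i + shift (snd (acts f ! j)) - 1) (slot j s))"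
      using content[OF e j s] we by simp
  qed
  have head_ok: "sat ?\<alpha> (inst_clauses (lens T t (T + 1)) head_templates)" if t: "t < T" for t
  proof (subst sat_head, simp, intro allI impI conjI)
    fix f j s assume f: "f < length trs" and j: "j < tapes N" and s: "s < length gs" and "?\<alpha> (var T t 0 f)"
    then have [simp]: "f = \<tau> t" using choice[OF f] by blast
    show "\<not> ?\<alpha> (var T t (T + 1) (slot j s))" if "gs ! s \<noteq> reads f ! j"
      using that content[of "T + 1" j s t] j s \<tau>(3)[OF t] len[of t] t by (simp add: cell_0)
    show "?\<alpha> (var T (Suc t) (T + 1 + shift (snd (acts f ! j)) - 1) (slot j s))" if w: "gs ! s = fst (acts f ! j)"
    proof -
      obtain e where we: "acts (\<tau> t) ! j = (gs ! s, e)" using w by (metis \<open>f = \<tau> t\<close> prod.collapse)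
      have e: "T + 1 + shift e - 1 < 2 * T + 3" using shift[of e] by linarith
      have "cell (snd (cs (Suc t)) ! j) (int (T + 1 + shift e - 1) - int T - 1) = gs ! s"
        unfolding nxt[OF t j] we cell_act by simp
      then show ?thesis using content[OF e j s] we by simp
    qed
  qed
  have init_ok: "sat ?\<alpha> (inst_clauses (lens T 0 i) (init_templates b))"
    if "i < 2 * T + 3" "b = (if i < T + 1 then Blank else input_symbol x (i - (T + 1)))" for i b
    unfolding sat_init
  proof (intro allI impI)
    fix j s assume j: "j < tapes N" and s: "s < length gs" and eq: "gs ! s = (if j = 0 then b else Blank)"
    have "0 \<le> int i - int T - 1 \<longleftrightarrow> \<not> i < T + 1" "nat (int i - int T - 1) = i - (T + 1)" by auto
    then have "cell (snd (cs 0) ! j) (int i - int T - 1) = gs ! s"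
      unfolding cs(1) cell_init[OF j] using eq that(2) by simp
    then show "?\<alpha> (var T 0 i (slot j s))" using content[OF that(1) j s] by simp
  qed
  have start_ok: "sat ?\<alpha> (inst_clauses (lens T 0 0) start_templates)"
    unfolding sat_start using choice[of _ 0] \<tau>(2)[of 0] cs(1) by (auto simp: init_def)
  have row_ok: "sat ?\<alpha> (inst_clauses (lens T t 0) row_templates)" if t: "t < T" for t
    unfolding sat_row
  proof (intro conjI allI impI)
    show "\<exists>f<length trs. ?\<alpha> (var T t 0 f)" using choice[OF \<tau>(1)[OF t], of t] \<tau>(1)[OF t] t by auto
    fix f f' assume f: "f < length trs" "f' < length trs" "dst f \<noteq> src f'"
    show "\<not> ?\<alpha> (var T t 0 f) \<or> \<not> ?\<alpha> (var T (Suc t) 0 f')"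
      using choice[OF f(1), of t] choice[OF f(2), of "Suc t"] f(3) \<tau>(4)[OF t] \<tau>(2)[of "Suc t"] by auto
  qed
  have "sat ?\<alpha> (tableau_clauses T x)"
    unfolding sat_tableau
    by (intro conjI allI impI start_ok init_ok row_ok cell_ok head_ok) auto
  then show ?thesis by blast
qed

text \<open>The factor \<open>T + 1\<close> counts rows 0 to \<open>T\<close>: clauses of a row
  below \<open>T\<close> also mention the next row.\<close>

lemma tableau_vars:
  assumes "cl \<in> set (tableau_clauses T x)" "(s, v) \<in> set cl"
  shows "2 \<le> v \<and> v < 2 + slots * ((2 * T + 3) * (T + 1))"
proof -
  have bound: "var T t i f < 2 + slots * ((2 * T + 3) * (T + 1))" if "t \<le> T" "i < 2 * T + 3" "f < slots" for t i f
  proof -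
    have "t * (2 * T + 3) + i < Suc t * (2 * T + 3)" using that by simp
    also have "\<dots> \<le> (T + 1) * (2 * T + 3)" using that by (intro mult_le_mono1) simp
    finally have "slots * Suc (t * (2 * T + 3) + i) \<le> slots * ((2 * T + 3) * (T + 1))"
      by (intro mult_le_mono2) (simp add: mult.commute)
    then show ?thesis using that(3) by (simp add: var_def)
  qed
  have shift: "shift d \<le> 2" for d by (cases d) auto
  \<comment> \<open>Some templates reach into the next row and into a neighboring cell. The side
    conditions on \<open>t\<close> and \<open>i\<close> keep these within the tableau.\<close>
  have inst: "\<exists>t'\<le>T. \<exists>i'<2 * T + 3. \<exists>f<slots. v = var T t' i' f"
    if cl: "cl \<in> set (inst_clauses (lens T t i) tpl)" and ti: "t \<le> T" "i < 2 * T + 3"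
      and tpl: "tpl \<in> {start_templates} \<union> range init_templates \<or>
       t < T \<and> (tpl = row_templates \<or> tpl \<in> {cell_templates, head_templates} \<and> 1 \<le> i \<and> i \<le> 2 * T + 1)" for t i tpl
  proof -
    obtain ls l where l: "ls \<in> set tpl" "l \<in> set ls" "v = snd (inst_lit (lens T t i) l)"
      using cl assms(2) by (fastforce simp: inst_clauses_def)
    have A: "\<exists>t'\<le>T. \<exists>i'<2 * T + 3. \<exists>f<slots. v = var T t' i' f"
      if "v = var T t' i' f" "t' \<le> T" "i' < 2 * T + 3" "f < slots" for t' i' f
      using that by blast
    consider \<tau> where "l = start_lit \<tau>" "\<tau> < length trs"
      | j s where "l = init_lit (slot j s)" "j < tapes N" "s < length gs"
      | b \<tau> where "l = row_lit b \<tau>" "\<tau> < length trs" "t < T"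
      | b \<tau> where "l = next_row_lit b \<tau>" "\<tau> < length trs" "t < T"
      | b j s where "l = cell_lit b (slot j s)" "j < tapes N" "s < length gs" "t < T"
      | d j s where "l = next_cell_lit d (slot j s)" "j < tapes N" "s < length gs" "t < T" "1 \<le> i" "i \<le> 2 * T + 1"
      using tpl l(1,2)
      by (auto simp: start_templates_def init_templates_def row_templates_def cell_templates_def
          head_templates_def)
    then show ?thesis
    proof cases
      case (1 \<tau>)
      then show ?thesis using l(3) ti choice_less by (intro A[of 0 0 \<tau>]) auto
    next
      case (2 j s)
      then show ?thesis using l(3) ti slot_less by (intro A[of 0 i "slot j s"]) auto
    next
      case (3 b \<tau>)
      then show ?thesis using l(3) ti choice_less by (intro A[of t 0 \<tau>]) auto
    next
      case (4 b \<tau>)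
      then show ?thesis using l(3) ti choice_less by (intro A[of "Suc t" 0 \<tau>]) auto
    next
      case (5 b j s)
      then show ?thesis using l(3) ti slot_less by (intro A[of t i "slot j s"]) auto
    next
      case 6
      then have "i + shift d - 1 < 2 * T + 3" using shift[of d] by linarith
      then show ?thesis using 6 l(3) slot_less by (intro A) auto
    qed
  qed
  have "\<exists>t'\<le>T. \<exists>i'<2 * T + 3. \<exists>f<slots. v = var T t' i' f"
    using assms(1) unfolding tableau_clauses_def init_clauses_def row_clauses_def
    by (auto intro: inst)
  then show ?thesis using bound by (auto simp: var_def)
qed

end

section \<open>Printing the rows of the tableau\<close>

abbreviation (input) "outerT \<equiv> 5 :: nat"
abbreviation (input) "innerT \<equiv> 6 :: nat"
abbreviation (input) "baseT \<equiv> 7 :: nat"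
abbreviation (input) "powT i \<equiv> 8 + i :: nat"

lemma enc_clauses_append: "enc_clauses (xs @ ys) = enc_clauses xs @ enc_clauses ys"
  by (simp add: enc_clauses_def)

lemma enc_clauses_concat_map:
  "enc_clauses (concat (map f xs)) = concat (map (\<lambda>i. enc_clauses (f i)) xs)"
  by (induction xs) (simp_all add: enc_clauses_append, simp add: enc_clauses_def)

lemma un_0: "un 0 = ([], 0)"
  by (simp add: un_def)

text \<open>The number \<open>e\<close> will be the exponent of the time bound. Since the tapes
  \<open>powT 0\<close> to \<open>powT e\<close> hold the powers below it, the reduction works on
  tapes 0 to \<open>8 + e\<close> and on \<open>out\<close>.\<close>

locale generator = tableau N trs gs + printer k out for N trs gs k out +
  fixes e :: nat
  assumes e: "8 + e < out"
begin

lemma tape_ok: "j \<le> 8 + e \<Longrightarrow> j < k" "j \<le> 8 + e \<Longrightarrow> j \<noteq> out"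
  using e out by auto

definition advance :: "nat \<Rightarrow> com" where
  "advance j = put j (replicate slots True)"

definition templates :: "template list list set" where
  "templates = {start_templates, row_templates, cell_templates, head_templates, init_templates Blank,
     init_templates (Bit True), init_templates (Bit False)}"

text \<open>One bound for all elementary actions: the \<open>clauses_cost\<close> terms pay for
  printing a template, \<open>2 * slots\<close> for an \<open>advance\<close>, and 9 for adding
  \<open>widthT\<close> to a register with \<open>add_tape\<close>.\<close>

definition cost :: "nat \<Rightarrow> nat" where
  "cost Z = (clauses_cost start_templates + clauses_cost row_templates + clauses_cost cell_templates +
     clauses_cost head_templates + clauses_cost (init_templates Blank) +
     clauses_cost (init_templates (Bit True)) + clauses_cost (init_templates (Bit False)) +
     2 * slots + 9) * (Z + 1)"

lemma gen_templates:
  assumes "tpl \<in> templates" "regs J Z len \<sigma>" "template_tapes tpl \<subseteq> J"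
  shows "gen (print_clauses tpl) \<sigma> (cost Z) (enc_clauses (inst_clauses len tpl)) \<sigma>"
proof -
  have "clauses_cost tpl * (Z + 1) \<le> cost Z"
    unfolding cost_def using assms(1) by (intro mult_le_mono1) (auto simp: templates_def)
  then show ?thesis using gen_mono[OF gen_print_clauses[OF assms(2,3)]] by blast
qed

lemma gen_advance:
  assumes "j \<le> 8 + e" "\<sigma> j = un b"
  shows "gen (advance j) \<sigma> (cost Z) [] (\<sigma>(j := un (b + slots)))"
proof -
  have "2 * slots * 1 \<le> cost Z" unfolding cost_def by (intro mult_le_mono) auto
  then show ?thesis
    unfolding advance_def using gen_mono[OF gen_grow[of j \<sigma> b slots]] tape_ok[OF assms(1)] assms by simp
qed

lemma template_tapes_simps:
  "template_tapes start_templates \<subseteq> {}"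
  "template_tapes (init_templates b) \<subseteq> {initT}"
  "template_tapes row_templates \<subseteq> {rowT, widthT}"
  "template_tapes cell_templates \<subseteq> {cellT, rowT, widthT}"
  "template_tapes head_templates \<subseteq> {cellT, rowT, widthT}"
  by (auto simp: template_tapes_def start_templates_def init_templates_def row_templates_def
      cell_templates_def head_templates_def lit_defs)

lemma regs_row:
  assumes "\<sigma> rowT = un (slots * (t * (2 * T + 3)))" "\<sigma> widthT = un (slots * (2 * T + 2))"
    "slots * (t * (2 * T + 3)) \<le> Z" "slots * (2 * T + 2) \<le> Z"
  shows "regs {rowT, widthT} Z (lens T t i) \<sigma>"
  using assms tape_ok by (auto simp: regs_def lens_def)

lemma regs_cell:
  assumes "\<sigma> rowT = un (slots * (t * (2 * T + 3)))" "\<sigma> widthT = un (slots * (2 * T + 2))"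
    "\<sigma> cellT = un (slots * (t * (2 * T + 3) + i))"
    "slots * (t * (2 * T + 3) + i) \<le> Z" "slots * (2 * T + 2) \<le> Z"
  shows "regs {cellT, rowT, widthT} Z (lens T t i) \<sigma>"
proof -
  have "slots * (t * (2 * T + 3)) \<le> slots * (t * (2 * T + 3) + i)" by (intro mult_le_mono2) simp
  from order_trans[OF this assms(4)] show ?thesis using assms tape_ok by (auto simp: regs_def lens_def)
qed

lemma regs_init:
  assumes "\<sigma> initT = un (slots * i)" "slots * i \<le> Z"
  shows "regs {initT} Z (lens T 0 i) \<sigma>"
  using assms tape_ok by (auto simp: regs_def lens_def)

definition cells :: com where
  "cells = Walk innerT (print_clauses cell_templates ;; advance cellT) ;; Rewind innerT"

text \<open>The first \<open>advance\<close> skips cell 0 and the last one skips cell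
  \<open>2 * T + 2\<close>, so \<open>cellT\<close> ends at the start of the next row. There
  \<open>rowT\<close> catches up by the \<open>2 * T + 2\<close> cells of \<open>widthT\<close> and
  one more.\<close>

definition row :: com where
  "row = print_clauses row_templates ;; advance cellT ;; cells ;;
     (print_clauses head_templates ;; advance cellT) ;; cells ;; advance cellT ;;
     add_tape widthT rowT ;; advance rowT"

text \<open>Beyond the input word the input head reads blanks, exactly as
  \<open>input_symbol\<close> prescribes, so a single routine serves the head cell and everything to
  its right.\<close>

definition read_cell :: com where
  "read_cell = Cond (\<lambda>rs. rs ! inputT = Bit True) (print_clauses (init_templates (Bit True)))
       (Cond (\<lambda>rs. rs ! inputT = Bit False) (print_clauses (init_templates (Bit False)))
         (print_clauses (init_templates Blank))) ;;
     Act inputT (\<lambda>s. (s, Rgt)) ;; advance initT"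

definition init_row :: com where
  "init_row = print_clauses start_templates ;; advance initT ;;
     Walk innerT (print_clauses (init_templates Blank) ;; advance initT) ;; Rewind innerT ;;
     read_cell ;; Walk innerT read_cell ;; Rewind innerT"

lemma gen_cell:
  assumes tpl: "tpl \<in> {cell_templates, head_templates}"
    and \<sigma>: "\<sigma> rowT = un (slots * (t * (2 * T + 3)))" "\<sigma> widthT = un (slots * (2 * T + 2))"
      "\<sigma> cellT = un (slots * (t * (2 * T + 3) + i))"
    and Z: "slots * (t * (2 * T + 3) + i) \<le> Z" "slots * (2 * T + 2) \<le> Z"
  shows "gen (print_clauses tpl ;; advance cellT) \<sigma> (2 * cost Z + 1)
    (enc_clauses (inst_clauses (lens T t i) tpl)) (\<sigma>(cellT := un (slots * (t * (2 * T + 3) + Suc i))))"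
proof -
  have 1: "gen (print_clauses tpl) \<sigma> (cost Z) (enc_clauses (inst_clauses (lens T t i) tpl)) \<sigma>"
    by (rule gen_templates[OF _ regs_cell[OF \<sigma> Z]])
      (use tpl template_tapes_simps in \<open>auto simp: templates_def\<close>)
  have 2: "gen (advance cellT) \<sigma> (cost Z) [] (\<sigma>(cellT := un (slots * (t * (2 * T + 3) + i) + slots)))"
    by (rule gen_advance) (use \<sigma> in auto)
  show ?thesis by (rule gen_weaken[OF gen_Seq[OF 1 2]]) (auto simp: algebra_simps)
qed

lemma gen_Rewind_un:
  assumes "j \<le> 8 + e" "\<sigma> j = un a"
  shows "gen (Rewind j) \<sigma> (3 * a + 5) [] (\<sigma>(j := (replicate a (Bit True), 0)))"
  by (rule gen_Rewind) (use assms tape_ok in \<open>auto simp: un_def\<close>)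

lemma gen_cells:
  assumes \<sigma>: "\<sigma> rowT = un (slots * (t * (2 * T + 3)))" "\<sigma> widthT = un (slots * (2 * T + 2))"
      "\<sigma> cellT = un (slots * (t * (2 * T + 3) + i))" "\<sigma> innerT = (replicate T (Bit True), 0)"
    and Z: "slots * (t * (2 * T + 3) + i + T) \<le> Z" "slots * (2 * T + 2) \<le> Z"
  shows "gen cells \<sigma> (T * (2 * cost Z + 8) + 7)
    (enc_clauses (concat (map (\<lambda>l. inst_clauses (lens T t (i + l)) cell_templates) [0..<T])))
    (\<sigma>(cellT := un (slots * (t * (2 * T + 3) + (i + T)))))"
proof -
  define St where "St l = \<sigma>(cellT := un (slots * (t * (2 * T + 3) + (i + l))))" for l
  have 1: "gen (Walk innerT (print_clauses cell_templates ;; advance cellT)) \<sigma> (T * (2 * cost Z + 1 + 4) + 1)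
    (concat (map (\<lambda>l. enc_clauses (inst_clauses (lens T t (i + l)) cell_templates)) [0..<T]))
    ((St T)(innerT := un T))"
  proof (rule gen_Walk_un)
    fix l \<rho> assume l: "l < T"
    have "slots * (t * (2 * T + 3) + (i + l)) \<le> slots * (t * (2 * T + 3) + i + T)"
      using l by (intro mult_le_mono2) simp
    from order_trans[OF this Z(1)] have "gen (print_clauses cell_templates ;; advance cellT) ((St l)(innerT := \<rho>)) (2 * cost Z + 1)
      (enc_clauses (inst_clauses (lens T t (i + l)) cell_templates))
      ((St l)(innerT := \<rho>, cellT := un (slots * (t * (2 * T + 3) + Suc (i + l)))))"
      using \<sigma> Z(2) by (intro gen_cell) (auto simp: St_def)
    then show "gen (print_clauses cell_templates ;; advance cellT) ((St l)(innerT := \<rho>)) (2 * cost Z + 1)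
      (enc_clauses (inst_clauses (lens T t (i + l)) cell_templates)) ((St (Suc l))(innerT := \<rho>))"
      by (rule gen_weaken) (auto simp: St_def fun_eq_iff)
  qed (use \<sigma> tape_ok in \<open>auto simp: St_def\<close>)
  have 2: "gen (Rewind innerT) ((St T)(innerT := un T)) (3 * T + 5) []
      ((St T)(innerT := un T, innerT := (replicate T (Bit True), 0)))"
    by (rule gen_Rewind_un) auto
  show ?thesis
    unfolding cells_def
    by (rule gen_weaken[OF gen_Seq[OF 1 2]])
      (use \<sigma> in \<open>auto simp: St_def enc_clauses_concat_map algebra_simps fun_eq_iff\<close>)
qed

text \<open>The bound pays for seven elementary actions and two sweeps over \<open>T\<close> cells;
  \<open>Z\<close> is the size of the whole tableau in slots and so dominates every
  register.\<close>

lemma gen_row: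
  assumes \<sigma>: "\<sigma> rowT = un (slots * (t * (2 * T + 3)))" "\<sigma> widthT = un (slots * (2 * T + 2))"
      "\<sigma> cellT = un (slots * (t * (2 * T + 3)))" "\<sigma> innerT = (replicate T (Bit True), 0)"
    and t: "t < T" and Z: "Z = slots * ((2 * T + 3) * (T + 1))"
  shows "gen row \<sigma> (7 * cost Z + 2 * (T * (2 * cost Z + 8) + 7) + 8) (enc_clauses (row_clauses T t))
    (\<sigma>(cellT := un (slots * (Suc t * (2 * T + 3))), rowT := un (slots * (Suc t * (2 * T + 3)))))"
proof -
  define W where "W = t * (2 * T + 3)"
  have bound: "slots * (W + i) \<le> Z" if "i \<le> 2 * T + 3" for i
  proof -
    have "W + i \<le> Suc t * (2 * T + 3)" using that by (simp add: W_def)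
    also have "\<dots> \<le> (T + 1) * (2 * T + 3)" using t by (intro mult_le_mono1) simp
    finally show ?thesis unfolding Z by (intro mult_le_mono2) (simp add: mult.commute)
  qed
  have width: "slots * (2 * T + 2) \<le> Z" unfolding Z by (intro mult_le_mono2) simp
  have nine: "9 * (slots * (2 * T + 2)) + 7 \<le> cost Z"
  proof -
    have "9 * w + 7 \<le> 9 * (Z + 1)" if "w \<le> Z" for w using that by simp
    from this[OF width] have "9 * (slots * (2 * T + 2)) + 7 \<le> 9 * (Z + 1)" .
    also have "\<dots> \<le> cost Z" unfolding cost_def by (intro mult_le_mono1) simp
    finally show ?thesis .
  qed
  define S where "S i = \<sigma>(cellT := un (slots * (W + i)))" for i
  have S: "S i rowT = un (slots * (t * (2 * T + 3)))" "S i widthT = un (slots * (2 * T + 2))"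
    "S i cellT = un (slots * (t * (2 * T + 3) + i))" "S i innerT = (replicate T (Bit True), 0)"
    "S 0 = \<sigma>" "(S i)(cellT := un (slots * (t * (2 * T + 3) + j))) = S j" for i j
    using \<sigma> by (auto simp: S_def W_def fun_upd_idem)
  have 1: "gen (print_clauses row_templates) (S 0) (cost Z)
      (enc_clauses (inst_clauses (lens T t 0) row_templates)) (S 0)"
    by (rule gen_templates[OF _ regs_row[of "S 0", OF S(1,2) _ width]])
      (use bound[of 0] template_tapes_simps in \<open>auto simp: templates_def W_def\<close>)
  have 2: "gen (advance cellT) (S i) (cost Z) [] (S (Suc i))" for i
    using gen_weaken[OF gen_advance[of cellT "S i" "slots * (W + i)" Z], of "cost Z" "[]" "S (Suc i)"]
    by (auto simp: S_def algebra_simps)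
  have 3: "gen cells (S i) (T * (2 * cost Z + 8) + 7)
    (enc_clauses (concat (map (\<lambda>l. inst_clauses (lens T t (i + l)) cell_templates) [0..<T]))) (S (i + T))"
    if "i + T \<le> 2 * T + 3" for i
    using gen_cells[of "S i" t T i Z, OF S(1-4) _ width] bound[OF that] unfolding S(6) W_def
    by (simp add: add.assoc)
  have 4: "gen (print_clauses head_templates ;; advance cellT) (S (T + 1)) (2 * cost Z + 1)
      (enc_clauses (inst_clauses (lens T t (T + 1)) head_templates)) (S (T + 2))"
    using gen_cell[of head_templates "S (T + 1)" t T "T + 1" Z, OF _ S(1-3) _ width] bound[of "T + 1"]
    unfolding S(6) W_def by simp
  have 5: "gen (add_tape widthT rowT) (S (2 * T + 3)) (cost Z) []
      ((S (2 * T + 3))(rowT := un (slots * W + slots * (2 * T + 2))))"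
    by (rule gen_mono[OF gen_add_tape nine]) (use S tape_ok in \<open>auto simp: W_def\<close>)
  have 6: "gen (advance rowT) ((S (2 * T + 3))(rowT := un (slots * W + slots * (2 * T + 2)))) (cost Z) []
      ((S (2 * T + 3))(rowT := un (slots * W + slots * (2 * T + 2)),
         rowT := un (slots * W + slots * (2 * T + 2) + slots)))"
    by (rule gen_advance) auto
  have c1: "gen cells (S (Suc 0)) (T * (2 * cost Z + 8) + 7)
    (enc_clauses (concat (map (\<lambda>l. inst_clauses (lens T t (1 + l)) cell_templates) [0..<T]))) (S (T + 1))"
    using 3[of 1] by simp
  have c2: "gen cells (S (T + 2)) (T * (2 * cost Z + 8) + 7)
    (enc_clauses (concat (map (\<lambda>l. inst_clauses (lens T t (T + 2 + l)) cell_templates) [0..<T]))) (S (2 * T + 2))"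
  proof -
    have eq: "T + 2 + T = 2 * T + 2" by simp
    show ?thesis using 3[of "T + 2", unfolded eq] by simp
  qed
  have a2: "gen (advance cellT) (S (2 * T + 2)) (cost Z) [] (S (2 * T + 3))"
    using 2[of "2 * T + 2"] by (simp add: numeral_3_eq_3)
  show ?thesis
    unfolding row_def
    by (rule gen_weaken[OF gen_Seq[OF 1[unfolded S(5)] gen_Seq[OF 2[of 0, unfolded S(5)] gen_Seq[OF c1
          gen_Seq[OF 4 gen_Seq[OF c2 gen_Seq[OF a2 gen_Seq[OF 5 6]]]]]]]])
      (auto simp: row_clauses_def enc_clauses_append S_def W_def fun_eq_iff algebra_simps)
qed

lemma gen_init_row:
  assumes \<sigma>: "\<sigma> initT = un 0" "\<sigma> innerT = (replicate T (Bit True), 0)" "\<sigma> inputT = (map Bit x, 0)"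
    and Z: "Z = slots * ((2 * T + 3) * (T + 1))"
  shows "gen init_row \<sigma> (T * (4 * cost Z + 20) + 4 * cost Z + 30) (enc_clauses (init_clauses T x))
    (\<sigma>(initT := un (slots * (2 * T + 2)), inputT := (map Bit x, int (T + 1))))"
proof -
  have bound: "slots * i \<le> Z" if "i \<le> 2 * T + 3" for i
    unfolding Z using that by (intro mult_le_mono2) (metis le_add2 mult.right_neutral mult_le_mono order_trans)
  define S where "S i p = \<sigma>(initT := un (slots * i), inputT := (map Bit x, int p))" for i p
  have S0: "S 0 0 = \<sigma>" using \<sigma> by (auto simp: S_def fun_upd_idem)
  have cell: "gen (print_clauses (init_templates b)) ((S i p)(innerT := \<rho>)) (cost Z)
      (enc_clauses (inst_clauses (lens T 0 i) (init_templates b))) ((S i p)(innerT := \<rho>))"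
    if "i \<le> 2 * T + 3" "b \<in> {Blank, Bit True, Bit False}" for i p b \<rho>
    by (rule gen_templates[OF _ regs_init[OF _ bound[OF that(1)]]])
      (use that template_tapes_simps in \<open>auto simp: templates_def S_def\<close>)
  have adv: "gen (advance initT) ((S i p)(innerT := \<rho>)) (cost Z) [] ((S (Suc i) p)(innerT := \<rho>))" for i p \<rho>
    by (rule gen_weaken[OF gen_advance[of _ _ "slots * i"]]) (auto simp: S_def fun_eq_iff algebra_simps)
  have read: "gen read_cell ((S i p)(innerT := \<rho>)) (2 * cost Z + 5)
      (enc_clauses (inst_clauses (lens T 0 i) (init_templates (input_symbol x p)))) ((S (Suc i) (Suc p))(innerT := \<rho>))"
    if i: "i \<le> 2 * T + 3" for i p \<rho>
  proof -
    let ?S = "(S i p)(innerT := \<rho>)"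
    have sym: "read_tape (tape_of (?S inputT)) = input_symbol x p"
      by (simp add: S_def input_symbol_def)
    have "gen (Cond (\<lambda>rs. rs ! inputT = Bit True) (print_clauses (init_templates (Bit True)))
       (Cond (\<lambda>rs. rs ! inputT = Bit False) (print_clauses (init_templates (Bit False)))
         (print_clauses (init_templates Blank)))) ?S (cost Z + 1 + 1)
      (enc_clauses (inst_clauses (lens T 0 i) (init_templates (input_symbol x p)))) ?S"
    proof (rule gen_Cond, goal_cases)
      case 3
      show ?case
      proof (cases "input_symbol x p = Bit True")
        case True
        then show ?thesis using gen_mono[OF cell[OF i, of "Bit True" p \<rho>]] sym by simp
      next
        case False
        have "gen (Cond (\<lambda>rs. rs ! inputT = Bit False) (print_clauses (init_templates (Bit False)))
          (print_clauses (init_templates Blank))) ?S (cost Z + 1)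
          (enc_clauses (inst_clauses (lens T 0 i) (init_templates (input_symbol x p)))) ?S"
        proof (rule gen_Cond, goal_cases)
          case 3
          have "input_symbol x p \<in> {Bit False, Blank}"
            using False by (auto simp: input_symbol_def split: if_splits)
          then show ?case using cell[OF i, of "Bit False" p \<rho>] cell[OF i, of Blank p \<rho>] sym by auto
        qed (use tape_ok[of 0] in auto)
        then show ?thesis using False sym by simp
      qed
    qed (use tape_ok[of 0] in auto)
    moreover have "gen (Act inputT (\<lambda>s. (s, Rgt))) ?S 1 [] (?S(inputT := (map Bit x, int (Suc p))))"
    proof (rule gen_Act)
      have "?S inputT = (map Bit x, int p)" by (simp add: S_def)
      then show "act (read_tape (tape_of (?S inputT)), Rgt) (tape_of (?S inputT)) =
          tape_of (map Bit x, int (Suc p))"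
        by (simp only: act_move) (simp add: add.commute)
    qed (use tape_ok[of 0] in auto)
    moreover have "?S(inputT := (map Bit x, int (Suc p))) = (S i (Suc p))(innerT := \<rho>)"
      by (auto simp: S_def fun_eq_iff)
    ultimately have "gen read_cell ?S (cost Z + 1 + 1 + (1 + cost Z + 1) + 1)
        (enc_clauses (inst_clauses (lens T 0 i) (init_templates (input_symbol x p))) @ [] @ [])
        ((S (Suc i) (Suc p))(innerT := \<rho>))"
      unfolding read_cell_def by (intro gen_Seq[OF _ gen_Seq[OF _ adv]]) simp_all
    then show ?thesis by (rule gen_weaken) auto
  qed
  have start: "gen (print_clauses start_templates) (S 0 0) (cost Z)
      (enc_clauses (inst_clauses (lens T 0 0) start_templates)) (S 0 0)"
    by (rule gen_templates[of _ "{}"]) (use template_tapes_simps in \<open>auto simp: templates_def regs_def\<close>)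
  have inner: "(S i p)(innerT := (replicate T (Bit True), 0)) = S i p" for i p
    using \<sigma>(2) by (auto simp: S_def fun_eq_iff)
  have adv0: "gen (advance initT) (S 0 0) (cost Z) [] (S 1 0)"
    using adv[of 0 0 "(replicate T (Bit True), 0)"] by (simp add: inner)
  have left: "gen (Walk innerT (print_clauses (init_templates Blank) ;; advance initT)) (S 1 0)
      (T * (2 * cost Z + 1 + 4) + 1)
      (concat (map (\<lambda>i. enc_clauses (inst_clauses (lens T 0 (1 + i)) (init_templates Blank))) [0..<T]))
      ((S (1 + T) 0)(innerT := un T))"
  proof (rule gen_Walk_un[where St = "\<lambda>i. S (1 + i) 0"])
    fix i \<rho> assume "i < T"
    then show "gen (print_clauses (init_templates Blank) ;; advance initT) ((S (1 + i) 0)(innerT := \<rho>))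
      (2 * cost Z + 1) (enc_clauses (inst_clauses (lens T 0 (1 + i)) (init_templates Blank)))
      ((S (1 + Suc i) 0)(innerT := \<rho>))"
      by (intro gen_weaken[OF gen_Seq[OF cell adv]]) auto
  qed (use \<sigma> tape_ok in \<open>auto simp: S_def\<close>)
  have rewind: "gen (Rewind innerT) ((S i p)(innerT := un T)) (3 * T + 5) [] (S i p)" for i p
    by (rule gen_weaken[OF gen_Rewind_un[of _ _ T]]) (auto simp: inner)
  have mid: "gen read_cell (S (1 + T) 0) (2 * cost Z + 5)
      (enc_clauses (inst_clauses (lens T 0 (T + 1)) (init_templates (input_symbol x 0)))) (S (T + 2) 1)"
    using read[of "1 + T" 0 "(replicate T (Bit True), 0)"] by (simp add: inner)
  have right: "gen (Walk innerT read_cell) (S (T + 2) 1) (T * (2 * cost Z + 5 + 4) + 1)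
      (concat (map (\<lambda>i. enc_clauses (inst_clauses (lens T 0 (T + 2 + i))
        (init_templates (input_symbol x (Suc i))))) [0..<T]))
      ((S (T + 2 + T) (Suc T))(innerT := un T))"
  proof (rule gen_Walk_un[where St = "\<lambda>i. S (T + 2 + i) (Suc i)"])
    fix i \<rho> assume "i < T"
    then show "gen read_cell ((S (T + 2 + i) (Suc i))(innerT := \<rho>)) (2 * cost Z + 5)
      (enc_clauses (inst_clauses (lens T 0 (T + 2 + i)) (init_templates (input_symbol x (Suc i)))))
      ((S (T + 2 + Suc i) (Suc (Suc i)))(innerT := \<rho>))"
      using read[of "T + 2 + i" "Suc i" \<rho>] by simp
  qed (use \<sigma> tape_ok in \<open>auto simp: S_def\<close>)
  have eq: "T + 2 + T = 2 * T + 2" by simp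
  show ?thesis
    unfolding init_row_def
    by (rule gen_weaken[OF gen_Seq[OF start[unfolded S0] gen_Seq[OF adv0[unfolded S0] gen_Seq[OF left
          gen_Seq[OF rewind gen_Seq[OF mid gen_Seq[OF right rewind]]]]]]])
      (simp add: algebra_simps,
       simp add: init_clauses_def enc_clauses_append enc_clauses_concat_map del: One_nat_def,
       simp only: S_def eq, simp)
qed

end

section \<open>The reduction program\<close>

context generator
begin

text \<open>The next power arises by adding the base once for every mark of the current
  power.\<close>

fun powers :: "nat \<Rightarrow> com" where
  "powers 0 = Skip"
| "powers (Suc i) = powers i ;; Rewind (powT i) ;; Walk (powT i) (add_tape baseT (powT (Suc i)))"

definition prepare :: com where
  "prepare = put baseT [True, True] ;; Walk inputT (put baseT [True]) ;; Rewind inputT ;;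
     put (powT 0) [True] ;; powers e"

text \<open>Two copies of \<open>T\<close> are made because the loops over rows and over cells are
  nested and each needs its own counter. The \<open>2 * slots\<close> marks per round, with a final
  \<open>2 * slots\<close>, give \<open>slots * (2 * T + 2)\<close> on
  \<open>widthT\<close>.\<close>

definition spread :: com where
  "spread = Rewind (powT e) ;;
     Walk (powT e) (put outerT [True] ;; put innerT [True] ;; put widthT (replicate (2 * slots) True)) ;;
     put widthT (replicate (2 * slots) True) ;; Rewind outerT ;; Rewind innerT"

text \<open>The first \<open>False\<close> ends the unary vertex number, and the \<open>True\<close>
  after it announces the first sample.\<close>

definition header_bits :: "bool list" where
  "header_bits = False # True # enc_sample ([(0, 1)], True)"

definition print_row_length :: com where
  "print_row_length = add_tape widthT out ;; put out (replicate slots True)"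

text \<open>The vertex number in unary: two marks for vertices 0 and 1, then \<open>T\<close> row
  lengths from the loop and one more for row \<open>T\<close>.\<close>

definition header :: com where
  "header = put out [True, True] ;; Walk outerT print_row_length ;; Rewind outerT ;;
     print_row_length ;; put out header_bits"

definition reduce :: com where
  "reduce = prepare ;; spread ;; header ;; init_row ;; Walk outerT row ;; put out [False]"

definition pow_state :: "bool list \<Rightarrow> nat \<Rightarrow> nat \<Rightarrow> symbol list \<times> int" where
  "pow_state x i j = (if j = inputT then (map Bit x, 0) else if j = baseT then un (length x + 2)
     else if 8 \<le> j \<and> j \<le> 8 + i then un ((length x + 2) ^ (j - 8)) else un 0)"

definition start_state :: "bool list \<Rightarrow> nat \<Rightarrow> symbol list \<times> int" where
  "start_state x = (\<lambda>_. ([], 0))(inputT := (map Bit x, 0))"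

lemma gen_powers:
  assumes "i \<le> e" and T: "T = (length x + 2) ^ e"
  shows "gen (powers i) (pow_state x 0) (i * (T * (9 * length x + 32) + 8)) [] (pow_state x i)"
  using assms(1)
proof (induction i)
  case 0
  show ?case by (simp add: gen_Skip)
next
  case (Suc i)
  define B where "B = length x + 2"
  have le: "B ^ i \<le> T" unfolding T B_def using Suc.prems by (intro power_increasing) auto
  have 1: "gen (Rewind (powT i)) (pow_state x i) (3 * B ^ i + 5) []
      ((pow_state x i)(powT i := (replicate (B ^ i) (Bit True), 0)))"
    using Suc.prems by (intro gen_Rewind_un) (auto simp: pow_state_def B_def)
  have 2: "gen (Walk (powT i) (add_tape baseT (powT (Suc i))))
      ((pow_state x i)(powT i := (replicate (B ^ i) (Bit True), 0))) (B ^ i * (9 * B + 7 + 4) + 1)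
      (concat (map (\<lambda>_. []) [0..<B ^ i])) ((pow_state x i)(powT (Suc i) := un (B ^ i * B), powT i := un (B ^ i)))"
  proof (rule gen_Walk_un[where St = "\<lambda>l. (pow_state x i)(powT (Suc i) := un (l * B))"])
    fix l \<rho>
    let ?S = "(pow_state x i)(powT (Suc i) := un (l * B), powT i := \<rho>)"
    have "gen (add_tape baseT (powT (Suc i))) ?S (9 * B + 7) [] (?S(powT (Suc i) := un (l * B + B)))"
      using Suc.prems tape_ok[of "powT (Suc i)"] tape_ok[of baseT]
      by (intro gen_add_tape) (auto simp: pow_state_def B_def)
    then show "gen (add_tape baseT (powT (Suc i))) ?S (9 * B + 7) []
        ((pow_state x i)(powT (Suc i) := un (Suc l * B), powT i := \<rho>))"
      by (rule gen_weaken) (auto simp: fun_eq_iff add.commute)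
  qed (use Suc.prems tape_ok[of "powT i"] in \<open>auto simp: pow_state_def un_0\<close>)
  have eq: "(pow_state x i)(powT (Suc i) := un (B ^ i * B), powT i := un (B ^ i)) = pow_state x (Suc i)"
    by (auto simp: fun_eq_iff pow_state_def B_def mult.commute)
  have IH: "gen (powers i) (pow_state x 0) (i * (T * (9 * length x + 32) + 8)) [] (pow_state x i)"
    using Suc by simp
  have "B ^ i * (9 * B + 7 + 4) \<le> T * (9 * length x + 29)" 
    by (rule mult_le_mono[OF le]) (simp add: B_def)
  then have le': "i * (T * (9 * length x + 32) + 8) +
      (3 * B ^ i + 5 + (B ^ i * (9 * B + 7 + 4) + 1) + 1) + 1 \<le> Suc i * (T * (9 * length x + 32) + 8)"
    using le by (simp add: distrib_left)
  show ?case
    unfolding powers.simps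
    by (rule gen_weaken[OF gen_Seq[OF IH gen_Seq[OF 1 2]] le']) (simp_all only: eq, simp)
qed

lemma gen_prepare:
  assumes T: "T = (length x + 2) ^ e"
  shows "gen prepare (start_state x) (9 * length x + 16 + e * (T * (9 * length x + 32) + 8)) []
    (pow_state x e)"
proof -
  define S where "S a i = (start_state x)(baseT := un a, inputT := (map Bit x, int i))" for a i
  have S0: "S 0 0 = start_state x" by (auto simp: S_def start_state_def un_0)
  have grow: "gen (put baseT (replicate b True)) (S a i) (2 * b) [] (S (a + b) i)" for a b i
    by (rule gen_weaken[OF gen_grow]) (use tape_ok[of baseT] in \<open>auto simp: S_def\<close>)
  have 1: "gen (put baseT [True, True]) (start_state x) 4 [] (S 2 0)"
  proof -
    have two: "replicate 2 True = [True, True]" by (simp add: numeral_2_eq_2)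
    show ?thesis using grow[of 2 0 0, unfolded two S0 add_0] by (simp del: put.simps)
  qed
  have "gen (Walk inputT (put baseT [True])) (S (2 + 0) 0) (length x * (2 + 4) + 1)
      (concat (map (\<lambda>_. []) [0..<length x])) (S (2 + length x) (length x))"
  proof (rule gen_Walk[where w = "map Bit x" and St = "\<lambda>i. S (2 + i) i"])
    fix i
    have "gen (put baseT [True]) (S (2 + i) i) 2 [] (S (2 + i + 1) i)"
      using grow[of 1 "2 + i" i] by (simp del: put.simps)
    then show "gen (put baseT [True]) (S (2 + i) i) 2 []
        ((S (2 + Suc i) (Suc i))(inputT := (map Bit x, int i)))"
      by (rule gen_weaken) (auto simp: S_def)
  qed (use tape_ok[of 0] in \<open>auto simp: S_def\<close>)
  then have 2: "gen (Walk inputT (put baseT [True])) (S 2 0) (length x * (2 + 4) + 1)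
      (concat (map (\<lambda>_. []) [0..<length x])) (S (2 + length x) (length x))"
    by (simp only: add_0_right)
  have 3: "gen (Rewind inputT) (S (2 + length x) (length x)) (3 * length x + 5) []
      ((S (2 + length x) (length x))(inputT := (map Bit x, 0)))"
    by (rule gen_Rewind) (use tape_ok[of 0] in \<open>auto simp: S_def\<close>)
  have 4: "gen (put (powT 0) [True]) ((S (2 + length x) (length x))(inputT := (map Bit x, 0))) 2 []
      ((S (2 + length x) (length x))(inputT := (map Bit x, 0), powT 0 := un (0 + 1)))"
    using gen_grow[of "powT 0" "(S (2 + length x) (length x))(inputT := (map Bit x, 0))" 0 1] tape_ok[of 8]
    by (simp add: S_def start_state_def un_0 del: put.simps)
  have eq: "(S (2 + length x) (length x))(inputT := (map Bit x, 0), powT 0 := un (0 + 1)) = pow_state x 0"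
    by (auto simp: fun_eq_iff S_def start_state_def pow_state_def un_0)
  note 5 = gen_powers[OF order_refl T]
  show ?thesis
    unfolding prepare_def
    by (rule gen_weaken[OF gen_Seq[OF 1 gen_Seq[OF 2 gen_Seq[OF 3 gen_Seq[OF 4[unfolded eq] 5]]]]]) auto
qed

definition spread_state :: "bool list \<Rightarrow> nat \<Rightarrow> nat \<Rightarrow> symbol list \<times> int" where
  "spread_state x T = (pow_state x e)(outerT := (replicate T (Bit True), 0),
     innerT := (replicate T (Bit True), 0), widthT := un (slots * (2 * T + 2)))"

lemma gen_spread:
  assumes T: "T = (length x + 2) ^ e"
  shows "gen spread (pow_state x e) (T * (4 * slots + 19) + 4 * slots + 20) [] (spread_state x T)"
proof -
  define S where "S l = (pow_state x e)(outerT := un l, innerT := un l, widthT := un (2 * slots * l))" for l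
  have 1: "gen (Rewind (powT e)) (pow_state x e) (3 * T + 5) []
      ((pow_state x e)(powT e := (replicate T (Bit True), 0)))"
    by (rule gen_Rewind_un) (auto simp: pow_state_def T)
  have 2: "gen (Walk (powT e) (put outerT [True] ;; put innerT [True] ;; put widthT (replicate (2 * slots) True)))
      ((pow_state x e)(powT e := (replicate T (Bit True), 0))) (T * (4 * slots + 6 + 4) + 1)
      (concat (map (\<lambda>_. []) [0..<T])) ((S T)(powT e := un T))"
  proof (rule gen_Walk_un)
    fix l \<rho>
    let ?S = "(S l)(powT e := \<rho>)"
    have a: "gen (put outerT [True]) ?S 2 [] (?S(outerT := un (l + 1)))"
      using gen_grow[of outerT ?S l 1] tape_ok[of outerT] by (simp add: S_def del: put.simps)
    have b: "gen (put innerT [True]) (?S(outerT := un (l + 1))) 2 [] (?S(outerT := un (l + 1), innerT := un (l + 1)))"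
      using gen_grow[of innerT "?S(outerT := un (l + 1))" l 1] tape_ok[of innerT]
      by (simp add: S_def del: put.simps)
    have c: "gen (put widthT (replicate (2 * slots) True)) (?S(outerT := un (l + 1), innerT := un (l + 1)))
        (2 * (2 * slots)) []
        (?S(outerT := un (l + 1), innerT := un (l + 1), widthT := un (2 * slots * l + 2 * slots)))"
      by (rule gen_grow) (use tape_ok[of widthT] in \<open>auto simp: S_def\<close>)
    show "gen (put outerT [True] ;; put innerT [True] ;; put widthT (replicate (2 * slots) True)) ?S
        (4 * slots + 6) [] ((S (Suc l))(powT e := \<rho>))"
      by (rule gen_weaken[OF gen_Seq[OF a gen_Seq[OF b c]]]) (auto simp: S_def fun_eq_iff algebra_simps)
  qed (use tape_ok[of "powT e"] in \<open>auto simp: S_def pow_state_def\<close>)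
  have eq: "(S T)(powT e := un T) = S T" by (auto simp: S_def fun_eq_iff pow_state_def T)
  have 3: "gen (put widthT (replicate (2 * slots) True)) (S T) (2 * (2 * slots)) []
      ((S T)(widthT := un (2 * slots * T + 2 * slots)))"
    by (rule gen_grow) (use tape_ok[of widthT] in \<open>auto simp: S_def\<close>)
  have 4: "gen (Rewind outerT) ((S T)(widthT := un (2 * slots * T + 2 * slots))) (3 * T + 5) []
      ((S T)(widthT := un (2 * slots * T + 2 * slots), outerT := (replicate T (Bit True), 0)))"
    by (rule gen_Rewind_un) (auto simp: S_def)
  have 5: "gen (Rewind innerT)
      ((S T)(widthT := un (2 * slots * T + 2 * slots), outerT := (replicate T (Bit True), 0))) (3 * T + 5) []
      ((S T)(widthT := un (2 * slots * T + 2 * slots), outerT := (replicate T (Bit True), 0),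
        innerT := (replicate T (Bit True), 0)))"
    by (rule gen_Rewind_un) (auto simp: S_def)
  show ?thesis
    unfolding spread_def
    by (rule gen_weaken[OF gen_Seq[OF 1 gen_Seq[OF 2[unfolded eq] gen_Seq[OF 3 gen_Seq[OF 4 5]]]]])
      (auto simp: S_def spread_state_def fun_eq_iff algebra_simps)
qed

definition vertices :: "nat \<Rightarrow> nat" where
  "vertices T = 2 + slots * ((2 * T + 3) * (T + 1))"

lemma concat_replicate_map: "concat (map (\<lambda>_. replicate a b) [0..<n]) = replicate (n * a) b"
  by (induction n) (simp_all add: replicate_add[symmetric] add.commute)

lemma gen_print_row_length:
  assumes "\<sigma> widthT = un (slots * (2 * T + 2))"
  shows "gen print_row_length \<sigma> (9 * (slots * (2 * T + 2)) + 7 + 2 * slots + 1)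
    (replicate (slots * (2 * T + 3)) True) \<sigma>"
proof -
  have "gen (add_tape widthT out) \<sigma> (9 * (slots * (2 * T + 2)) + 7) (replicate (slots * (2 * T + 2)) True) \<sigma>"
    by (rule gen_print_tape) (use assms tape_ok[of widthT] in auto)
  from gen_Seq[OF this gen_print[of "replicate slots True"]] show ?thesis
    unfolding print_row_length_def
    by (rule gen_weaken) (auto simp: replicate_add[symmetric] algebra_simps)
qed

lemma gen_header:
  "gen header (spread_state x T) ((T + 1) * (9 * (slots * (2 * T + 2)) + 2 * slots + 20) + 40)
    (enc_nat (vertices T) @ True # enc_sample ([(0, 1)], True)) (spread_state x T)"
proof -
  let ?R = "9 * (slots * (2 * T + 2)) + 7 + 2 * slots + 1"
  let ?S = "spread_state x T"
  have 1: "gen (put out [True, True]) ?S 4 [True, True] ?S"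
    using gen_print[of "[True, True]"] by simp
  have 2: "gen (Walk outerT print_row_length) ?S (T * (?R + 4) + 1)
      (concat (map (\<lambda>_. replicate (slots * (2 * T + 3)) True) [0..<T])) (?S(outerT := un T))"
  proof (rule gen_Walk_un[where St = "\<lambda>_. ?S"])
    show "gen print_row_length (?S(outerT := \<rho>)) ?R (replicate (slots * (2 * T + 3)) True) (?S(outerT := \<rho>))" for \<rho>
      by (rule gen_print_row_length) (simp add: spread_state_def)
  qed (use tape_ok[of outerT] in \<open>auto simp: spread_state_def\<close>)
  have 3: "gen (Rewind outerT) (?S(outerT := un T)) (3 * T + 5) [] ?S"
    by (rule gen_weaken[OF gen_Rewind_un]) (auto simp: spread_state_def)
  have 4: "gen print_row_length ?S ?R (replicate (slots * (2 * T + 3)) True) ?S"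
    by (rule gen_print_row_length) (simp add: spread_state_def)
  have bits: "[True, True] @ concat (map (\<lambda>_. replicate (slots * (2 * T + 3)) True) [0..<T]) @ [] @
      replicate (slots * (2 * T + 3)) True @ header_bits =
      enc_nat (vertices T) @ True # enc_sample ([(0, 1)], True)"
  proof -
    have "vertices T = Suc (Suc (T * (slots * (2 * T + 3)) + slots * (2 * T + 3)))"
      by (simp add: vertices_def algebra_simps)
    then show ?thesis by (simp add: concat_replicate_map enc_nat_def header_bits_def replicate_add)
  qed
  show ?thesis
    unfolding header_def
    by (rule gen_weaken[OF gen_Seq[OF 1 gen_Seq[OF 2 gen_Seq[OF 3 gen_Seq[OF 4 gen_print]]]] _ bits])
      (auto simp: header_bits_def enc_list_def enc_nat_def algebra_simps)
qed

text \<open>The bounds of the stages in the order of \<open>reduce\<close>; the final 7 consists of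
  the closing \<open>put\<close> and five sequencing steps.\<close>

definition reduce_time :: "nat \<Rightarrow> nat" where
  "reduce_time n = (let T = (n + 2) ^ e; C = cost (slots * ((2 * T + 3) * (T + 1))) in
     9 * n + 16 + e * (T * (9 * n + 32) + 8) + (T * (4 * slots + 19) + 4 * slots + 20) +
     ((T + 1) * (9 * (slots * (2 * T + 2)) + 2 * slots + 20) + 40) +
     (T * (4 * C + 20) + 4 * C + 30) +
     (T * (7 * C + 2 * (T * (2 * C + 8) + 7) + 8 + 4) + 1) + 7)"

lemma enc_cnf_inst:
  "enc_inst (n, cnf_samples cls) =
     (enc_nat n @ True # enc_sample ([(0, 1)], True)) @ enc_clauses cls @ [False]"
  by (simp add: cnf_samples_def enc_list_def enc_clauses_def comp_def)

text \<open>The second conjunct prepares the simulation, which must find the state tape and the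
  solver's work tapes still blank.\<close>

lemma gen_reduce:
  assumes T: "T = (length x + 2) ^ e"
  shows "\<exists>\<sigma>. gen reduce (start_state x) (reduce_time (length x))
      (enc_inst (vertices T, cnf_samples (tableau_clauses T x))) \<sigma> \<and> (\<forall>j>8 + e. \<sigma> j = ([], 0))"
proof -
  define Z where "Z = slots * ((2 * T + 3) * (T + 1))"
  define S where "S = (spread_state x T)(initT := un (slots * (2 * T + 2)), inputT := (map Bit x, int (T + 1)))"
  define R where "R t = S(cellT := un (slots * (t * (2 * T + 3))), rowT := un (slots * (t * (2 * T + 3))))" for t
  have 1: "gen init_row (spread_state x T) (T * (4 * cost Z + 20) + 4 * cost Z + 30)
      (enc_clauses (init_clauses T x)) S"
    unfolding S_def by (rule gen_init_row[OF _ _ _ Z_def]) (auto simp: spread_state_def pow_state_def)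
  have 2: "gen (Walk outerT row) S (T * (7 * cost Z + 2 * (T * (2 * cost Z + 8) + 7) + 8 + 4) + 1)
      (concat (map (\<lambda>t. enc_clauses (row_clauses T t)) [0..<T])) ((R T)(outerT := un T))"
  proof (rule gen_Walk_un)
    fix t \<rho> assume t: "t < T"
    have "gen row ((R t)(outerT := \<rho>)) (7 * cost Z + 2 * (T * (2 * cost Z + 8) + 7) + 8)
      (enc_clauses (row_clauses T t)) ((R t)(outerT := \<rho>,
        cellT := un (slots * (Suc t * (2 * T + 3))), rowT := un (slots * (Suc t * (2 * T + 3)))))"
      by (rule gen_row[OF _ _ _ _ t Z_def]) (auto simp: R_def S_def spread_state_def)
    then show "gen row ((R t)(outerT := \<rho>)) (7 * cost Z + 2 * (T * (2 * cost Z + 8) + 7) + 8)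
      (enc_clauses (row_clauses T t)) ((R (Suc t))(outerT := \<rho>))"
      by (rule gen_weaken) (auto simp: R_def fun_eq_iff)
  qed (use tape_ok[of outerT] in \<open>auto simp: R_def S_def spread_state_def pow_state_def un_0\<close>)
  have 3: "gen (put out [False]) ((R T)(outerT := un T)) 2 [False] ((R T)(outerT := un T))"
    using gen_print[of "[False]"] by simp
  have "gen reduce (start_state x) (reduce_time (length x))
      (enc_inst (vertices T, cnf_samples (tableau_clauses T x))) ((R T)(outerT := un T))"
    unfolding reduce_def
  proof (rule gen_weaken[OF gen_Seq[OF gen_prepare[OF T] gen_Seq[OF gen_spread[OF T] gen_Seq[OF gen_header
          gen_Seq[OF 1 gen_Seq[OF 2 3]]]]]], goal_cases)
    case 1
    show ?case by (simp only: reduce_time_def Let_def T[symmetric] Z_def[symmetric])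
  next
    case 2
    show ?case
      by (simp only: enc_cnf_inst tableau_clauses_def enc_clauses_append enc_clauses_concat_map append_assoc
          append_Nil)
  qed (rule refl)
  moreover have "((R T)(outerT := un T)) j = ([], 0)" if "j > 8 + e" for j
    using that by (auto simp: R_def S_def spread_state_def pow_state_def un_0)
  ultimately show ?thesis by blast
qed

lemma wf_com_reduce:
  assumes G: "range Bit \<subseteq> G"
  shows "wf_com k G reduce"
proof -
  have "wf_com k G (powers i)" for i
    by (induction i) (auto simp: wf_com_Rewind wf_com_Walk wf_com_add_tape G)
  then show ?thesis
    by (simp add: reduce_def prepare_def spread_def header_def print_row_length_def init_row_def read_cell_def
        row_def cells_def advance_def wf_com_Rewind wf_com_Walk wf_com_add_tape wf_com_put wf_com_Act
        wf_com_print_clauses G del: put.simps)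
qed

end

section \<open>Simulating the solver\<close>

definition poly_bounded :: "(nat \<Rightarrow> nat) \<Rightarrow> bool" where
  "poly_bounded f \<longleftrightarrow> (\<exists>p :: nat poly. \<forall>n. f n \<le> poly p n)"

lemma poly_bounded_const: "poly_bounded (\<lambda>n. c)"
  unfolding poly_bounded_def by (intro exI[of _ "[:c:]"]) simp

lemma poly_bounded_id: "poly_bounded (\<lambda>n. n)"
  unfolding poly_bounded_def by (intro exI[of _ "[:0, 1:]"]) simp

lemma poly_bounded_add: "poly_bounded f \<Longrightarrow> poly_bounded g \<Longrightarrow> poly_bounded (\<lambda>n. f n + g n)"
  unfolding poly_bounded_def by (metis poly_add add_mono)

lemma poly_bounded_mult: "poly_bounded f \<Longrightarrow> poly_bounded g \<Longrightarrow> poly_bounded (\<lambda>n. f n * g n)"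
  unfolding poly_bounded_def by (metis poly_mult mult_le_mono)

lemma poly_bounded_power: "poly_bounded f \<Longrightarrow> poly_bounded (\<lambda>n. f n ^ c)"
  by (induction c) (auto intro: poly_bounded_const poly_bounded_mult)

lemma poly_nat_mono: "a \<le> b \<Longrightarrow> poly p a \<le> poly (p :: nat poly) b"
  by (induction p) (auto intro: mult_le_mono add_mono)

lemma poly_bounded_poly:
  assumes "poly_bounded f"
  shows "poly_bounded (\<lambda>n. poly p (f n))"
proof -
  obtain q where "\<forall>n. f n \<le> poly q n" using assms by (auto simp: poly_bounded_def)
  then show ?thesis
    unfolding poly_bounded_def by (intro exI[of _ "pcompose p q"]) (simp add: poly_pcompose poly_nat_mono)
qed

lemmas poly_bounded_intros =
  poly_bounded_add poly_bounded_mult poly_bounded_power poly_bounded_const poly_bounded_id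

text \<open>The base \<open>n + 2\<close> is at least 2 even for \<open>n = 0\<close>, so a
  coefficient is absorbed by \<open>a < 2 ^ a \<le> (n + 2) ^ a\<close>. One further factor
  \<open>n + 2\<close> pays for the multiplication by \<open>n\<close> and for the coefficient
  itself.\<close>

lemma poly_less_power: "\<exists>e. \<forall>n. poly (p :: nat poly) n < (n + 2) ^ e"
proof (induction p)
  case 0
  show ?case by (intro exI[of _ 0]) simp
next
  case (pCons a p)
  then obtain e where e: "\<And>n. poly p n < (n + 2) ^ e" by blast
  have "poly (pCons a p) n < (n + 2) ^ (a + Suc e)" for n
  proof -
    have "a < 2 ^ a" by (rule less_exp)
    also have "(2 :: nat) ^ a \<le> (n + 2) ^ a" by (rule power_mono) auto
    finally have a: "a < (n + 2) ^ a" .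
    define A where "A = (n + 2) ^ a"
    define Q where "Q = (n + 2) ^ e"
    have Q: "1 \<le> Q" "poly p n \<le> Q" using e[of n] by (auto simp: Q_def)
    have "a + n * poly p n \<le> a + n * Q" using Q by simp
    also have "\<dots> < A + A * n * Q" using a by (simp add: A_def add_less_le_mono)
    also have "\<dots> \<le> A * Q * 2 + A * n * Q" using Q by simp
    also have "\<dots> = (n + 2) ^ (a + Suc e)" by (simp add: A_def Q_def power_add algebra_simps)
    finally show ?thesis by simp
  qed
  then show ?case by blast
qed

lemma (in generator) poly_bounded_reduce_time: "poly_bounded reduce_time"
  unfolding reduce_time_def Let_def cost_def by (intro poly_bounded_intros)

section \<open>Head movement and output length\<close>

lemma cstep_head_move:
  assumes "cstep c d" "j < length (snd d)"
  shows "j < length (snd c) \<and> snd (snd d ! j) \<le> snd (snd c ! j) + 1"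
  using assms(1)
proof cases
  case (1 c0 ts c' as)
  have "snd (act a t) \<le> snd t + 1" for a t
    by (cases a; cases t; cases "snd a") auto
  then show ?thesis using 1 assms(2) by auto
qed

text \<open>Applied to the output tape, whose head ends just behind the printed word, this bounds
  the length of the instance by the running time of the reduction.\<close>

lemma runs_head_move:
  assumes "runs c ts T ts'" "j < length ts'"
  shows "snd (ts' ! j) \<le> snd (ts ! j) + int T"
proof -
  have "j < length (snd a) \<and> snd (snd b ! j) \<le> snd (snd a ! j) + int n"
    if "(cstep ^^ n) a b" "j < length (snd b)" for n a b
    using that
  proof (induction n arbitrary: b)
    case (Suc n)
    then obtain b' where b': "(cstep ^^ n) a b'" "cstep b' b" by auto
    show ?case using cstep_head_move[OF b'(2) Suc.prems(2)] Suc.IH[OF b'(1)] by auto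
  qed auto
  then show ?thesis using assms unfolding runs_def by fastforce
qed

text \<open>The state of the simulated machine \<open>M\<close> is kept on tape \<open>st\<close> as \<open>Aux q\<close>; the tapes of \<open>M\<close> follow.\<close>

definition sim_trans :: "tm \<Rightarrow> nat \<Rightarrow> symbol list \<Rightarrow> nat \<Rightarrow> (symbol \<times> dir) list \<Rightarrow> bool" where
  "sim_trans M st rs q' as \<longleftrightarrow> (\<exists>q. rs ! st = Aux q \<and> (q, drop (Suc st) rs, q', as) \<in> transitions M)"

text \<open>The \<open>nop\<close> branch keeps length and alphabet intact on readings without a
  transition, as \<open>wf_com\<close> asks of a \<open>Basic\<close> command on every
  reading.\<close>

definition sim_act :: "tm \<Rightarrow> nat \<Rightarrow> symbol list \<Rightarrow> (symbol \<times> dir) list" where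
  "sim_act M st rs = (if \<exists>q' as. sim_trans M st rs q' as
     then (case SOME (q', as). sim_trans M st rs q' as of
       (q', as) \<Rightarrow> nop (take st rs) @ (Aux q', Stay) # as)
     else nop rs)"

definition simulate :: "tm \<Rightarrow> nat \<Rightarrow> com" where
  "simulate M st = While (\<lambda>rs. \<exists>q' as. sim_trans M st rs q' as) (Basic (sim_act M st))"

definition state_tape :: "nat \<Rightarrow> tape" where
  "state_tape q = tape_of ([Aux q], 0)"

lemma read_state_tape: "read_tape (state_tape q) = Aux q"
  by (simp add: state_tape_def)

lemma sim_trans_config:
  "length pre = st \<Longrightarrow> sim_trans M st (map read_tape (pre @ state_tape q # ts)) q' as \<longleftrightarrow>
    (q, map read_tape ts, q', as) \<in> transitions M"
  by (auto simp: sim_trans_def nth_append read_state_tape)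

lemma runs_sim_act:
  assumes det: "deterministic M" and st: "length pre = st" and step: "step M (q, ts) (q', ts')"
  shows "runs (Basic (sim_act M st)) (pre @ state_tape q # ts) 1 (pre @ state_tape q' # ts')"
proof -
  obtain as where as: "(q, map read_tape ts, q', as) \<in> transitions M" "ts' = map2 act as ts"
    using step by (auto elim: step.cases)
  let ?rs = "map read_tape (pre @ state_tape q # ts)"
  have T: "sim_trans M st ?rs q' as" using sim_trans_config[OF st] as(1) by blast
  \<comment> \<open>Determinism identifies the transition picked by \<open>SOME\<close> with the one
    behind the given step.\<close>
  have "(SOME (q', as). sim_trans M st ?rs q' as) = (q', as)"
  proof (rule some_equality)
    fix p assume "case p of (q', as) \<Rightarrow> sim_trans M st ?rs q' as"
    then have "(q, map read_tape ts, fst p, snd p) \<in> transitions M"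
      by (simp only: sim_trans_config[OF st] split_beta)
    then have "fst p = q' \<and> snd p = as" using as(1) det unfolding deterministic_def by blast
    then show "p = (q', as)" by (simp add: prod_eq_iff)
  qed (use T in simp)
  then have "sim_act M st ?rs = nop (map read_tape pre) @ (Aux q', Stay) # as"
    using T st unfolding sim_act_def by auto
  moreover have "act (Aux q', Stay) (state_tape q) = state_tape q'"
    by (auto simp: state_tape_def fun_eq_iff)
  moreover have "length (nop (map read_tape pre)) = length pre" by (simp add: nop_def)
  ultimately have "map2 act (sim_act M st ?rs) (pre @ state_tape q # ts) = pre @ state_tape q' # ts'"
    using as(2) map2_act_nop[of pre] by (simp add: zip_append1)
  then show ?thesis using runs_Basic[of "sim_act M st" "pre @ state_tape q # ts"] by simp
qed

lemma runs_simulate: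
  assumes det: "deterministic M" and st: "length pre = st"
    and run: "(step M ^^ m) (q, ts) (q', ts')" and halt: "halted M (q', ts')"
  shows "runs (simulate M st) (pre @ state_tape q # ts) (m * 3 + 1) (pre @ state_tape q' # ts')"
proof -
  obtain cs where cs: "cs 0 = (q, ts)" "cs m = (q', ts')" "\<And>i. i < m \<Longrightarrow> step M (cs i) (cs (Suc i))"
    using run unfolding relpowp_fun_conv by blast
  define St where "St i = pre @ state_tape (fst (cs i)) # snd (cs i)" for i
  have "runs (simulate M st) (St 0) (m * (1 + 2) + 1) (St m)"
    unfolding simulate_def
  proof (rule runs_While)
    fix i assume i: "i < m"
    obtain qi ti where c: "cs i = (qi, ti)" by fastforce
    obtain qn tn where n: "cs (Suc i) = (qn, tn)" by fastforce
    have s: "step M (qi, ti) (qn, tn)" using cs(3)[OF i] c n by simp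
    have "\<exists>q' as. sim_trans M st (map read_tape (St i)) q' as"
      using s unfolding St_def sim_trans_config[OF st] by (auto simp: c elim!: step.cases)
    then show "(\<exists>q' as. sim_trans M st (map read_tape (St i)) q' as) \<and>
        runs (Basic (sim_act M st)) (St i) 1 (St (Suc i))"
      using runs_sim_act[OF det st s] by (simp add: St_def c n)
  next
    show "\<nexists>q' as. sim_trans M st (map read_tape (St m)) q' as"
      using halt unfolding St_def sim_trans_config[OF st] halted_def by (auto simp: cs intro: step.intros)
  qed
  then have "runs (simulate M st) (St 0) (m * 3 + 1) (St m)" by (rule runs_mono) simp
  then show ?thesis by (simp add: St_def cs)
qed

text \<open>The simulated state is a tape symbol, so every state that \<open>M\<close> can enter has
  to belong to the alphabet.\<close>

definition sim_symbols :: "tm \<Rightarrow> symbol set" where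
  "sim_symbols M = tape_symbols M \<union> Aux ` (insert (start M) ((\<lambda>(q, rs, q', as). q') ` transitions M))"

lemma finite_sim_symbols: "wf_tm M \<Longrightarrow> finite (sim_symbols M)"
  by (auto simp: sim_symbols_def finite_tape_symbols) (simp add: wf_tm_def)

lemma wf_com_simulate:
  assumes wf: "wf_tm M" and k: "k = Suc st + tapes M"
  shows "wf_com k (sim_symbols M) (simulate M st)"
  unfolding simulate_def wf_com.simps
proof (intro allI impI, elim conjE)
  fix rs assume rs: "length rs = k" "set rs \<subseteq> sim_symbols M"
  show "length (sim_act M st rs) = k \<and> fst ` set (sim_act M st rs) \<subseteq> sim_symbols M"
  proof (cases "\<exists>q' as. sim_trans M st rs q' as")
    case False
    then have "sim_act M st rs = nop rs" by (simp add: sim_act_def)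
    then show ?thesis using rs by (simp add: nop_def image_image)
  next
    case True
    define p where "p = (SOME (q', as). sim_trans M st rs q' as)"
    obtain q' as where p: "p = (q', as)" by (cases p)
    have "sim_trans M st rs q' as"
      using True someI_ex[of "\<lambda>(q', as). sim_trans M st rs q' as"] p unfolding p_def by auto
    then obtain q where tr: "(q, drop (Suc st) rs, q', as) \<in> transitions M" by (auto simp: sim_trans_def)
    have act: "sim_act M st rs = nop (take st rs) @ (Aux q', Stay) # as"
      using True p unfolding sim_act_def p_def by simp
    have "length as = tapes M" using wf tr by (auto simp: wf_tm_def)
    moreover have "fst ` set as \<subseteq> tape_symbols M"
      using UN_upper[OF tr, of "\<lambda>(q, rs, q', as). fst ` set as"] by (auto simp: tape_symbols_def)
    moreover have "Aux q' \<in> sim_symbols M" using tr by (force simp: sim_symbols_def)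
    moreover have "set (take st rs) \<subseteq> sim_symbols M" using rs(2) set_take_subset by fast
    ultimately show ?thesis
      using rs(1) k unfolding act by (auto simp: nop_def sim_symbols_def image_image)
  qed
qed

lemma tapes_of_start_state: "1 \<le> k \<Longrightarrow> 0 < j \<Longrightarrow>
    tapes_of k ((\<lambda>_. ([], 0))(0 := (map Bit x, 0), j := str [])) = input_tape x # replicate (k - 1) blank_tape"
  by (rule nth_equalityI)
    (auto simp: tapes_of_def str_def input_tape_def blank_tape_def nth_Cons' fun_eq_iff)

text \<open>The solver is assumed correct and fast only on codes of instances. The printed word is
  exactly such a code for every input, so both assumptions apply and the two polynomial bounds
  compose.\<close>

lemma solver_imp_NP_subset_P:
  assumes M: "wf_tm M" "deterministic M" "poly_time_on M (enc_inst ` instances)"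
    "solves_conscheck_2_coloring M"
  shows "class_NP \<subseteq> class_P"
proof
  fix L assume "L \<in> class_NP"
  then obtain N where N: "wf_tm N" "L = {x. accepts N x}" "poly_time_on N UNIV"
    unfolding class_NP_def by blast
  then obtain p where
    p: "\<And>x m c. (step N ^^ m) (init N x) c \<Longrightarrow> m \<le> poly (p :: nat poly) (length x)"
    unfolding poly_time_on_def by blast
  obtain e where pow: "\<And>n. poly p n < (n + 2) ^ e" using poly_less_power by blast
  obtain pM where pM: "\<And>x m c. x \<in> enc_inst ` instances \<Longrightarrow> (step M ^^ m) (init M x) c \<Longrightarrow>
      m \<le> poly (pM :: nat poly) (length x)"
    using M(3) unfolding poly_time_on_def by blast
  have wfN': "wf_tm (add_idle N)" using wf_add_idle[OF N(1)] .
  obtain trs where trs: "set trs = transitions (add_idle N)"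
    using wfN' finite_list[of "transitions (add_idle N)"] by (auto simp: wf_tm_def)
  obtain gs where gs: "set gs = tape_symbols (add_idle N)"
    using finite_list[OF finite_tape_symbols[OF wfN']] by blast
  define st where "st = 9 + e"
  \<comment> \<open>The output tape of the reduction is also the first tape of the simulated solver;
    rewinding it turns the printed instance into the solver's input.\<close>
  define out where "out = Suc st"
  define k where "k = Suc st + tapes M"
  have tM: "1 \<le> tapes M" using M(1) by (simp add: wf_tm_def)
  interpret generator "add_idle N" trs gs k out e
    by unfold_locales (use wfN' trs gs tM in \<open>auto simp: st_def out_def k_def\<close>)
  define prog where "prog = (reduce ;; Rewind out ;; Act st (\<lambda>_. (Aux (start M), Stay)) ;; simulate M st) ;;
    Cond (\<lambda>rs. rs ! out = Bit True) Accept Skip"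
  \<comment> \<open>The summands follow the sequencing of \<open>prog\<close>, with
    \<open>reduce_time n\<close> standing in for the length of the instance; the last two steps are
    the passage to the final test and the test itself.\<close>
  define F where "F n = reduce_time n + ((3 * reduce_time n + 5) + (1 + (poly pM (reduce_time n) * 3 + 1) + 1) + 1)
    + 1 + 1 + 1" for n
  have "\<exists>n c ts. (cstep ^^ n) (prog, input_tape x # replicate (k - 1) blank_tape) (c, ts) \<and>
      c \<in> {Skip, Accept} \<and> (c = Accept \<longleftrightarrow> accepts N x) \<and> n \<le> F (length x)" for x
  proof -
    define T where "T = (length x + 2) ^ e"
    define nv where "nv = vertices T"
    define S where "S = cnf_samples (tableau_clauses T x)"
    define y where "y = enc_inst (nv, S)"
    have vars: "\<forall>cl \<in> set (tableau_clauses T x). \<forall>(s, v) \<in> set cl. 2 \<le> v \<and> v < nv"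
      using tableau_vars by (fastforce simp: nv_def vertices_def)
    have nv: "2 \<le> nv" by (simp add: nv_def vertices_def)
    have inst: "(nv, S) \<in> instances" unfolding S_def by (rule cnf_samples_instance[OF nv vars])
    obtain a where a: "correct_answer {..<nv} (samples S) a" "outputs M y (enc_answer nv a)"
      using M(4) inst unfolding solves_conscheck_2_coloring_def y_def by blast
    have "accepts N x \<longleftrightarrow> (\<exists>d. (step (add_idle N) ^^ T) (init (add_idle N) x) d)"
    proof (rule accepts_iff_long_run[OF N(1)])
      fix m c assume "(step N ^^ m) (init N x) c"
      from le_less_trans[OF p[OF this] pow] show "m < T" unfolding T_def .
    qed
    also have "\<dots> \<longleftrightarrow> (\<exists>\<alpha>. sat \<alpha> (tableau_clauses T x))" using run_of_sat sat_of_run by blast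
    also have "\<dots> \<longleftrightarrow> (\<exists>X. consistent {..<nv} (samples S) X)"
      unfolding S_def using consistent_cnf_iff_sat[OF nv vars] by blast
    also have "\<dots> \<longleftrightarrow> a \<noteq> None" using a(1) by (cases a) auto
    finally have acc: "accepts N x \<longleftrightarrow> a \<noteq> None" .
    obtain q ts where c: "halts_with M y (q, ts)" "tape_output (hd ts) (enc_answer nv a)"
      using a(2) unfolding outputs_def by auto
    then obtain m where m: "(step M ^^ m) (init M y) (q, ts)" and halt: "halted M (q, ts)"
      unfolding halts_with_def by (auto dest: rtranclp_imp_relpowp)
    have "y \<in> enc_inst ` instances" unfolding y_def using inst by (rule imageI)
    then have m_le: "m \<le> poly pM (length y)" using pM m by blast
    obtain \<sigma> where \<sigma>: "gen reduce (start_state x) (reduce_time (length x)) y \<sigma>"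
      "\<And>j. j > 8 + e \<Longrightarrow> \<sigma> j = ([], 0)"
      using gen_reduce[OF T_def] unfolding y_def nv_def S_def by blast
    have init: "tapes_of k ((start_state x)(out := str [])) = input_tape x # replicate (k - 1) blank_tape"
      unfolding start_state_def by (rule tapes_of_start_state) (auto simp: k_def out_def)
    have r1: "runs reduce (input_tape x # replicate (k - 1) blank_tape) (reduce_time (length x))
        (tapes_of k (\<sigma>(out := str y)))"
      using \<sigma>(1) init unfolding gen_def by (metis append_Nil)
    have out_k: "out < k" and st_k: "st < k" using tM by (auto simp: out_def k_def)
    have y_le: "length y \<le> reduce_time (length x)"
    proof -
      have "snd (tapes_of k (\<sigma>(out := str y)) ! out) \<le>
          snd ((input_tape x # replicate (k - 1) blank_tape) ! out) + int (reduce_time (length x))"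
        by (rule runs_head_move[OF r1]) (simp add: tapes_of_def out_k)
      then show ?thesis
        using out_k by (simp add: tapes_of_def str_def out_def blank_tape_def)
    qed
    define \<sigma>1 where "\<sigma>1 = \<sigma>(out := (map Bit y, 0))"
    have r2: "runs (Rewind out) (tapes_of k (\<sigma>(out := str y))) (3 * length y + 5) (tapes_of k \<sigma>1)"
      using runs_Rewind[OF out_k, of "map Bit y" "length y" "\<sigma>(out := str y)"]
      by (auto simp: str_def \<sigma>1_def)
    define \<sigma>2 where "\<sigma>2 = \<sigma>1(st := ([Aux (start M)], 0))"
    have r3: "runs (Act st (\<lambda>_. (Aux (start M), Stay))) (tapes_of k \<sigma>1) 1 (tapes_of k \<sigma>2)"
      unfolding \<sigma>2_def by (rule runs_Act[OF st_k]) (auto simp: \<sigma>1_def \<sigma>(2) st_def out_def fun_eq_iff)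
    define pre where "pre = tapes_of st \<sigma>2"
    have split: "tapes_of k \<sigma>2 = pre @ state_tape (start M) # snd (init M y)"
    proof -
      have "[0..<k] = [0..<st] @ st # out # [Suc out..<k]"
      proof -
        have "[0..<k] = [0..<st] @ [st..<k]" using st_k upt_add_eq_append[of 0 st "k - st"] by simp
        also have "[st..<k] = st # out # [Suc out..<k]"
          using st_k out_k upt_conv_Cons[of st k] upt_conv_Cons[of out k] by (simp add: out_def)
        finally show ?thesis .
      qed
      moreover have "tape_of (\<sigma>2 st) = state_tape (start M)" by (simp add: \<sigma>2_def state_tape_def)
      moreover have "tape_of (\<sigma>2 out) = input_tape y"
        by (auto simp: \<sigma>2_def \<sigma>1_def out_def input_tape_def fun_eq_iff)
      moreover have "map (\<lambda>j. tape_of (\<sigma>2 j)) [Suc out..<k] = replicate (tapes M - 1) blank_tape"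
        by (rule nth_equalityI)
          (auto simp: \<sigma>2_def \<sigma>1_def \<sigma>(2) st_def out_def k_def blank_tape_def fun_eq_iff)
      ultimately show ?thesis by (simp add: tapes_of_def pre_def init_def)
    qed
    have len: "length pre = st" by (simp add: pre_def tapes_of_def)
    have r4: "runs (simulate M st) (tapes_of k \<sigma>2) (m * 3 + 1) (pre @ state_tape q # ts)"
      unfolding split using runs_simulate[OF M(2) len _ halt, of m "start M" "snd (init M y)"] m
      by (simp add: init_def)
    obtain n where n: "n \<le> reduce_time (length x) + ((3 * length y + 5) + (1 + (m * 3 + 1) + 1) + 1) + 1"
      "(cstep ^^ n) (reduce ;; Rewind out ;; Act st (\<lambda>_. (Aux (start M), Stay)) ;; simulate M st,
        input_tape x # replicate (k - 1) blank_tape) (Skip, pre @ state_tape q # ts)"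
      using runs_Seq[OF r1 runs_Seq[OF r2 runs_Seq[OF r3 r4]]] unfolding runs_def by blast
    have "length ts = tapes M"
      using reachable_tapes_over[OF M(1) order_refl m] by (simp add: tapes_over_def)
    then have hd: "map read_tape (pre @ state_tape q # ts) ! out = read_tape (hd ts)"
      using tM len by (cases ts) (auto simp: out_def nth_append)
    \<comment> \<open>The halted head stands on the first bit of the output, and
      \<open>enc_answer\<close> starts with \<open>True\<close> exactly when a set is
      returned.\<close>
    have "read_tape (hd ts) = Bit (enc_answer nv a ! 0)"
      using c(2) by (cases "hd ts"; cases a) auto
    also have "enc_answer nv a ! 0 = (a \<noteq> None)" by (cases a) auto
    finally have bit: "read_tape (hd ts) = Bit True \<longleftrightarrow> accepts N x" by (simp add: acc)
    let ?c = "if accepts N x then Accept else Skip"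
    have "cstep (Cond (\<lambda>rs. rs ! out = Bit True) Accept Skip, pre @ state_tape q # ts)
        (?c, pre @ state_tape q # ts)"
      by (rule cstep_nop) (simp add: hd bit del: map_append)
    then have "(cstep ^^ 1) (Cond (\<lambda>rs. rs ! out = Bit True) Accept Skip, pre @ state_tape q # ts)
        (?c, pre @ state_tape q # ts)"
      by (simp only: relpowp_1)
    from relpowp_Seq[OF n(2) this]
    have "(cstep ^^ (n + 1 + 1)) (prog, input_tape x # replicate (k - 1) blank_tape)
        (?c, pre @ state_tape q # ts)"
      by (simp only: prog_def)
    moreover have "n + 1 + 1 \<le> F (length x)"
    proof -
      have "m \<le> poly pM (reduce_time (length x))"
        using m_le poly_nat_mono[OF y_le] order_trans by blast
      then show ?thesis using n(1) y_le unfolding F_def by linarith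
    qed
    moreover have "?c \<in> {Skip, Accept}" "?c = Accept \<longleftrightarrow> accepts N x" by auto
    ultimately show ?thesis by blast
  qed
  note prog_run = this
  have G: "Blank \<in> sim_symbols M" "range Bit \<subseteq> sim_symbols M" "Aux (start M) \<in> sim_symbols M"
    by (auto simp: sim_symbols_def tape_symbols_def)
  have wf_prog: "wf_com k (sim_symbols M) prog"
    unfolding prog_def using wf_com_simulate[OF M(1) k_def] wf_com_reduce[OF G(2)]
    by (auto simp: wf_com_Rewind G(3) intro!: wf_com_Act)
  have k: "1 \<le> k" by (simp add: k_def)
  obtain D where D: "wf_tm D" "deterministic D"
    "\<forall>x n c ts. (cstep ^^ n) (prog, input_tape x # replicate (k - 1) blank_tape) (c, ts) \<and>
        c \<in> {Skip, Accept} \<longrightarrow>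
      (accepts D x \<longleftrightarrow> c = Accept) \<and> (\<forall>m d. (step D ^^ m) (init D x) d \<longrightarrow> m \<le> n)"
    using compile_correct[OF wf_prog finite_sim_symbols[OF M(1)] G(1,2) k] by (elim exE conjE)
  have run: "(accepts D x \<longleftrightarrow> accepts N x) \<and> (\<forall>m d. (step D ^^ m) (init D x) d \<longrightarrow> m \<le> F (length x))" for x
  proof -
    obtain n c ts where
      r: "(cstep ^^ n) (prog, input_tape x # replicate (k - 1) blank_tape) (c, ts)" "c \<in> {Skip, Accept}"
      and c: "c = Accept \<longleftrightarrow> accepts N x" and n: "n \<le> F (length x)"
      using prog_run[of x] by (elim exE conjE)
    have "(accepts D x \<longleftrightarrow> c = Accept) \<and> (\<forall>m d. (step D ^^ m) (init D x) d \<longrightarrow> m \<le> n)"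
      using D(3)[rule_format, OF conjI[OF r]] .
    then show ?thesis using c n by (meson order_trans)
  qed
  have "poly_bounded F"
    unfolding F_def
    by (intro poly_bounded_intros poly_bounded_reduce_time poly_bounded_poly)
  then obtain pF where "\<And>n. F n \<le> poly pF n" unfolding poly_bounded_def by blast
  then have "poly_time_on D UNIV"
    using run unfolding poly_time_on_def by (meson order_trans)
  moreover have "L = {x. accepts D x}" using run N(2) by blast
  ultimately show "L \<in> class_P" unfolding class_P_def using D(1,2) by blast
qed

theorem theorem3:
  assumes "class_P \<noteq> class_NP"
  shows "\<not> (\<exists>M. wf_tm M \<and> deterministic M \<and> poly_time_on M (enc_inst ` instances) \<and>
             solves_conscheck_2_coloring M)"
proof -
  have "class_P \<subseteq> class_NP" unfolding class_P_def class_NP_def by blast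
  then show ?thesis using assms solver_imp_NP_subset_P by blast
qed

end
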